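(* (a) Let $K\subset\mathbb R^2$ be a convex body with $0\in\operatorname{int}(K)$ satisfying $\rho_K(\pm(1,0)^T)=h_K(\pm(1,0)^T)=e^{\pm\lambda}$ for some $\lambda\in\mathbb R$ (equalities with upper signs and with lower signs). Let $K$ have no non-exposed points and let all corners of $K$ be polyhedral. Assume that $x_-:=-\rho_K(-(1,0)^T)\,(1,0)^T$ is a smooth extremal point of $K$ if and only if $x_+:=\rho_K((1,0)^T)\,(1,0)^T$ is a smooth extremal point of $K$. Then $L:=(K\cap H^+)\cup(K^*\cap H^-)$ is a self-dual convex body without non-exposed points. (b) For every planar self-dual convex body $K\subset\mathbb R^2$ without non-exposed points there exists a rotation $\psi\in SO(2)$ such that $\psi(K)$ satisfies (in place of $K$) all the assumptions in (a).
   Context: $\mathbb R^2$ carries the standard scalar product. A convex body is a compact convex set. $H^\pm=\{(x,y)^T\in\mathbb R^2\mid\pm y\ge 0\}$. For a convex body $K$ with $0\in\operatorname{int}(K)$: $h_K(u)=\sup\{\langle x,u\rangle\mid x\in K\}$, $\rho_K(u)=\sup\{\lambda\ge 0\mid\lambda u\in K\}$, $K^*=\{u\in\mathbb R^2\mid 1+\langle u,v\rangle\ge 0\ \forall v\in K\}$. $K$ is self-dual if $K^*=K$. A face of $K$ is a convex subset $F\subset K$ such that $x,y,z\in K$, $y\in F$ and $y\in\,]x,z[\,=\{(1-\lambda)x+\lambda z\mid 0<\lambda<1\}$ imply $x,z\in F$. A point $x\in K$ is extremal if $\{x\}$ is a face. For $u\ne0$ put $H_K(u)=\{x\mid\langle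 x,u\rangle=h_K(u)\}$; an extremal point $x$ is exposed if $\{x\}=K\cap H_K(u)$ for some $u\neq0$, and a non-exposed point otherwise. The normal cone at $x\in K$ is $N(x)=\{u\mid\langle u,y-x\rangle\le0\ \forall y\in K\}$; $\mathcal N_K$ is the set consisting of all $N(x)$, $x\in K$, and $\mathbb R^2$. A point $x\in K$ is smooth if $\dim N(x)=1$. An extremal point $x$ is a corner if $\dim N(x)=2$; then $N(x)$ has two distinct one-dimensional rays $r_1,r_2$ as faces, and the corner is polyhedral if $r_1,r_2\in\mathcal N_K$. *)

theory Defs
  imports "HOL-Analysis.Analysis"
begin

definition convex_body :: "(real^2) set \<Rightarrow> bool" where
  "convex_body K \<longleftrightarrow> compact K \<and> convex K"

definition upper_half :: "(real^2) set" where
  "upper_half = {x. x $ 2 \<ge> 0}"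

definition lower_half :: "(real^2) set" where
  "lower_half = {x. - (x $ 2) \<ge> 0}"

abbreviation e1 :: "real^2" where
  "e1 \<equiv> vector [1, 0]"

(* The suprema in support_fun and radial_fun are taken in the type real, hence
   meaningful only for bodies with 0 in the interior (and, for radial_fun, u \<noteq> 0). *)

definition support_fun :: "(real^2) set \<Rightarrow> real^2 \<Rightarrow> real" where
  "support_fun K u = Sup {x \<bullet> u | x. x \<in> K}"

definition radial_fun :: "(real^2) set \<Rightarrow> real^2 \<Rightarrow> real" where
  "radial_fun K u = Sup {l. l \<ge> 0 \<and> l *\<^sub>R u \<in> K}"

(* With this sign convention the dual is the reflection of the usual polar body. *)
definition dual_body :: "(real^2) set \<Rightarrow> (real^2) set" where
  "dual_body K = {u. \<forall>v\<in>K. 1 + u \<bullet> v \<ge> 0}"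

(* Duality is considered only for bodies with 0 in the interior. *)
definition self_dual :: "(real^2) set \<Rightarrow> bool" where
  "self_dual K \<longleftrightarrow> 0 \<in> interior K \<and> dual_body K = K"

definition support_line :: "(real^2) set \<Rightarrow> real^2 \<Rightarrow> (real^2) set" where
  "support_line K u = {x. x \<bullet> u = support_fun K u}"

definition exposed_point :: "(real^2) set \<Rightarrow> real^2 \<Rightarrow> bool" where
  "exposed_point K x \<longleftrightarrow>
     {x} face_of K \<and> (\<exists>u. u \<noteq> 0 \<and> {x} = K \<inter> support_line K u)"

definition nonexposed_point :: "(real^2) set \<Rightarrow> real^2 \<Rightarrow> bool" where
  "nonexposed_point K x \<longleftrightarrow> {x} face_of K \<and> \<not> exposed_point K x"

definition normal_cone :: "(real^2) set \<Rightarrow> real^2 \<Rightarrow> (real^2) set" where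
  "normal_cone K x = {u. \<forall>y\<in>K. u \<bullet> (y - x) \<le> 0}"

definition normal_cones :: "(real^2) set \<Rightarrow> (real^2) set set" where
  "normal_cones K = insert UNIV (normal_cone K ` K)"

definition smooth_point :: "(real^2) set \<Rightarrow> real^2 \<Rightarrow> bool" where
  "smooth_point K x \<longleftrightarrow> x \<in> K \<and> aff_dim (normal_cone K x) = 1"

definition smooth_extremal_point :: "(real^2) set \<Rightarrow> real^2 \<Rightarrow> bool" where
  "smooth_extremal_point K x \<longleftrightarrow> {x} face_of K \<and> smooth_point K x"

definition corner :: "(real^2) set \<Rightarrow> real^2 \<Rightarrow> bool" where
  "corner K x \<longleftrightarrow> {x} face_of K \<and> aff_dim (normal_cone K x) = 2"

(* If K has nonempty interior, the normal cone at a corner is pointed and its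
   one-dimensional faces are exactly its two boundary rays r1 and r2. *)
definition polyhedral_corner :: "(real^2) set \<Rightarrow> real^2 \<Rightarrow> bool" where
  "polyhedral_corner K x \<longleftrightarrow> corner K x \<and>
     (\<exists>r1 r2. r1 \<noteq> r2 \<and>
        {r. r face_of normal_cone K x \<and> aff_dim r = 1} = {r1, r2} \<and>
        r1 \<in> normal_cones K \<and> r2 \<in> normal_cones K)"

definition gluing_assumptions :: "(real^2) set \<Rightarrow> bool" where
  "gluing_assumptions K \<longleftrightarrow>
     convex_body K \<and> 0 \<in> interior K \<and>
     (\<exists>l::real.
        radial_fun K e1 = exp l \<and> support_fun K e1 = exp l \<and>
        radial_fun K (- e1) = exp (- l) \<and> support_fun K (- e1) = exp (- l)) \<and>
     (\<nexists>x. nonexposed_point K x) \<and>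
     (\<forall>x. corner K x \<longrightarrow> polyhedral_corner K x) \<and>
     (smooth_extremal_point K (- (radial_fun K (- e1) *\<^sub>R e1)) \<longleftrightarrow>
      smooth_extremal_point K (radial_fun K e1 *\<^sub>R e1))"

end

theory Submission
  imports Defs
begin

text \<open>
Everything is read off from the conjugate faces \<open>{w. w \<in> dual_body K, w \<bullet> x = - 1}\<close> of the points \<open>x\<close>
of a body \<open>K\<close> with the origin in its interior. The normal cone at \<open>x\<close> is the cone over the negated
conjugate face, so \<open>x\<close> is smooth if that face is a single point and a corner if it is a segment. A
point is exposed if it is itself the conjugate face of a point of the dual. For a corner, the
extreme rays of the normal cone lie over the ends of the conjugate segment, and they are normal
cones exactly if these ends are exposed points of the dual (\<open>polyhedral_corner_iff\<close>). Hence the dual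
of a body all of whose corners are polyhedral has no non-exposed points
(\<open>no_nonexposed_point_dual\<close>).

For the gluing, let the horizontal chord of \<open>K\<close> through the origin have end points \<open>a e1\<close> and
\<open>- c e1\<close>. The hypotheses say that \<open>a c = 1\<close> and that \<open>K\<close> lies in the vertical strip between these
points; the dual then has the same chord and lies in the same strip. Two points in the same half
plane have a scalar product of at least \<open>-1\<close> for this reason alone, and two points in opposite half
planes are compared by the duality of \<open>K\<close> and its dual. So the glued set \<open>L\<close> is its own dual
(\<open>dual_body_glue\<close>), which makes it closed and convex as well. Off the axis, \<open>L\<close> agrees locally with
\<open>K\<close> or with the dual, and neither has non-exposed points. On the axis only the ends of the chord
can be extreme. At an end \<open>p\<close>, with \<open>q\<close> the other end, exposedness could fail only if \<open>L\<close> has a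
vertical edge at \<open>p\<close> and none at \<open>q\<close>. Polyhedrality of the corners transfers smoothness of the
half-body to the whole body (\<open>smooth_extremal_point_of_one_sided\<close>), and then exactly one of \<open>p\<close> and
\<open>q\<close> is a smooth extremal point of \<open>K\<close>, which the hypothesis excludes (\<open>glue_exposed_on_axis\<close>).

Conversely, a self-dual body touches its circumscribed circle about the origin, of radius \<open>r\<close>, at
some point \<open>p\<close>; by duality it contains the disc of radius \<open>1/r\<close> and touches that disc at the
opposite point. A rotation that makes \<open>p\<close> horizontal brings it into gluing position
(\<open>gluing_assumptions_of_circumscribed\<close>).
\<close>

section \<open>Bodies around the origin and their duals\<close>

definition origin_body :: "(real^2) set \<Rightarrow> bool" where
  "origin_body K \<longleftrightarrow> convex_body K \<and> 0 \<in> interior K"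

lemma origin_bodyD:
  assumes "origin_body K"
  shows "compact K" "closed K" "convex K" "0 \<in> interior K" "0 \<in> K"
  using assms interior_subset by (auto simp: origin_body_def convex_body_def compact_imp_closed)

lemma inner_2: "x \<bullet> y = x $ 1 * y $ 1 + x $ 2 * y $ 2" for x y :: "real^2"
  by (simp add: inner_vec_def sum_2)

lemma vec2_eq_iff: "x = y \<longleftrightarrow> x $ 1 = y $ 1 \<and> x $ 2 = y $ 2" for x y :: "real^2"
  by (simp add: vec_eq_iff forall_2)

lemma dual_body_ge:
  assumes "w \<in> dual_body K" "v \<in> K"
  shows "w \<bullet> v \<ge> - 1" "v \<bullet> w \<ge> - 1"
  using assms by (auto simp: dual_body_def inner_commute)

lemma dual_bodyI: "(\<And>v. v \<in> K \<Longrightarrow> w \<bullet> v \<ge> - 1) \<Longrightarrow> w \<in> dual_body K"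
  by (force simp: dual_body_def)

lemma cball_subset_dual_body:
  assumes "\<And>v. v \<in> K \<Longrightarrow> norm v \<le> r" "r > 0"
  shows "cball 0 (1 / r) \<subseteq> dual_body K"
proof
  fix w assume "w \<in> cball (0::real^2) (1 / r)"
  then have w: "norm w \<le> 1 / r"
    by simp
  show "w \<in> dual_body K"
  proof (rule dual_bodyI)
    fix v assume "v \<in> K"
    have "\<bar>w \<bullet> v\<bar> \<le> norm w * norm v"
      by (rule Cauchy_Schwarz_ineq2)
    also have "\<dots> \<le> (1 / r) * r"
      by (rule mult_mono) (use w assms \<open>v \<in> K\<close> in auto)
    finally show "w \<bullet> v \<ge> - 1"
      using assms(2) by simp
  qed
qed

lemma dual_body_eq_Inter: "dual_body K = (\<Inter>v\<in>K. {u. v \<bullet> u \<ge> - 1})"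
  by (force simp: dual_body_def inner_commute)

lemma closed_dual_body: "closed (dual_body K)"
  unfolding dual_body_eq_Inter by (intro closed_INT ballI closed_halfspace_ge)

lemma convex_dual_body: "convex (dual_body K)"
  unfolding dual_body_eq_Inter by (intro convex_INT convex_halfspace_ge)

lemma origin_body_dual:
  assumes "origin_body K"
  shows "origin_body (dual_body K)"
proof -
  note K = origin_bodyD[OF assms]
  have "bounded (dual_body K)"
  proof -
    obtain e where e: "e > 0" "cball 0 e \<subseteq> K"
      using K(4) mem_interior_cball by blast
    have "norm w \<le> 1 / e" if w: "w \<in> dual_body K" for w
    proof (cases "w = 0")
      case False
      have "- (e / norm w) *\<^sub>R w \<in> K"
        using e False by (intro subsetD[OF e(2)]) simp
      from dual_body_ge(1)[OF w this] have "e * norm w \<le> 1"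
        using False by (simp add: power2_norm_eq_inner[symmetric] power2_eq_square)
      then show ?thesis
        using e by (simp add: field_simps)
    qed (use e in simp)
    then show ?thesis
      by (auto simp: bounded_iff)
  qed
  moreover have "0 \<in> interior (dual_body K)"
  proof -
    obtain r where "r > 0" "\<forall>v\<in>K. norm v \<le> r"
      using compact_imp_bounded[OF K(1)] bounded_pos by metis
    then have "cball 0 (1 / r) \<subseteq> dual_body K" "1 / r > 0"
      by (auto intro!: subsetD[OF cball_subset_dual_body])
    then show ?thesis
      using mem_interior_cball by blast
  qed
  ultimately show ?thesis
    using closed_dual_body convex_dual_body
    by (auto simp: origin_body_def convex_body_def compact_eq_bounded_closed)
qed

text \<open>The bipolar theorem: a point outside \<open>K\<close> is cut off by a line missing the origin, and the
  normal of that line, scaled so that the line has level \<open>-1\<close>, lies in the dual.\<close>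

lemma dual_body_dual_body:
  assumes "origin_body K"
  shows "dual_body (dual_body K) = K"
proof
  note K = origin_bodyD[OF assms]
  show "K \<subseteq> dual_body (dual_body K)"
    by (auto simp: dual_body_def inner_commute)
  show "dual_body (dual_body K) \<subseteq> K"
  proof (rule ccontr)
    assume "\<not> dual_body (dual_body K) \<subseteq> K"
    then obtain z where z: "z \<in> dual_body (dual_body K)" "z \<notin> K"
      by blast
    obtain a b where ab: "a \<bullet> z < b" "\<And>x. x \<in> K \<Longrightarrow> a \<bullet> x > b"
      using separating_hyperplane_closed_point[OF K(3) K(2) z(2)] by auto
    have "b < 0"
      using ab(2)[OF K(5)] by simp
    have "(- 1 / b) *\<^sub>R a \<in> dual_body K"
    proof (rule dual_bodyI)
      fix v assume "v \<in> K"
      from ab(2)[OF this] show "((- 1 / b) *\<^sub>R a) \<bullet> v \<ge> - 1"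
        using \<open>b < 0\<close> by (simp add: field_simps)
    qed
    from dual_body_ge(2)[OF z(1) this] ab(1) show False
      using \<open>b < 0\<close> by (simp add: field_simps)
  qed
qed

section \<open>Dual faces, exposed points and normal cones\<close>

text \<open>The conjugate face of a boundary point. It carries all the information about the normal
  cone that is needed: the normals at \<open>x\<close> are the negatives of the multiples of its points.\<close>

definition dual_face :: "(real^2) set \<Rightarrow> real^2 \<Rightarrow> (real^2) set" where
  "dual_face K x = {w \<in> dual_body K. w \<bullet> x = - 1}"

lemma dual_face_dual_body:
  assumes "origin_body K"
  shows "dual_face (dual_body K) w = {v \<in> K. v \<bullet> w = - 1}"
  by (simp add: dual_face_def dual_body_dual_body[OF assms])

lemma inner_pos_of_support:
  assumes "origin_body K" "u \<noteq> 0" "\<And>y. y \<in> K \<Longrightarrow> u \<bullet> y \<le> c"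
  shows "c > 0"
proof -
  obtain e where e: "e > 0" "cball 0 e \<subseteq> K"
    using origin_bodyD(4)[OF assms(1)] mem_interior_cball by blast
  have "(e / norm u) *\<^sub>R u \<in> K"
    using e assms(2) by (intro subsetD[OF e(2)]) simp
  from assms(3)[OF this] have "e * norm u \<le> c"
    using assms(2) by (simp add: power2_norm_eq_inner[symmetric] power2_eq_square)
  moreover have "e * norm u > 0"
    using e assms(2) by simp
  ultimately show ?thesis by linarith
qed

text \<open>A supporting line of \<open>K\<close> misses the origin, so it can be normalised to level \<open>-1\<close>; its normal
  is then a point of the dual.\<close>

lemma normalised_support:
  assumes "origin_body K" "u \<noteq> 0" "\<And>y. y \<in> K \<Longrightarrow> u \<bullet> y \<le> u \<bullet> x"
  shows "- (1 / (u \<bullet> x)) *\<^sub>R u \<in> dual_face K x" "u \<bullet> x > 0"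
proof -
  show pos: "u \<bullet> x > 0"
    by (rule inner_pos_of_support[OF assms])
  have "- (1 / (u \<bullet> x)) *\<^sub>R u \<in> dual_body K"
  proof (rule dual_bodyI)
    fix v assume "v \<in> K"
    then show "- (1 / (u \<bullet> x)) *\<^sub>R u \<bullet> v \<ge> - 1"
      using assms(3) pos by (simp add: field_simps)
  qed
  then show "- (1 / (u \<bullet> x)) *\<^sub>R u \<in> dual_face K x"
    using pos by (simp add: dual_face_def)
qed

lemma mem_normal_cone_iff:
  assumes "origin_body K" "x \<in> K"
  shows "u \<in> normal_cone K x \<longleftrightarrow> u = 0 \<or> (\<exists>t>0. \<exists>w\<in>dual_face K x. u = - t *\<^sub>R w)"
proof
  assume u: "u \<in> normal_cone K x"
  show "u = 0 \<or> (\<exists>t>0. \<exists>w\<in>dual_face K x. u = - t *\<^sub>R w)"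
  proof (cases "u = 0")
    case False
    have le: "u \<bullet> y \<le> u \<bullet> x" if "y \<in> K" for y
      using u that by (auto simp: normal_cone_def inner_diff_right)
    note ns = normalised_support[OF assms(1) False le]
    have "u = - (u \<bullet> x) *\<^sub>R (- (1 / (u \<bullet> x)) *\<^sub>R u)"
      using ns(2) by simp
    then show ?thesis
      using ns by blast
  qed simp
next
  assume "u = 0 \<or> (\<exists>t>0. \<exists>w\<in>dual_face K x. u = - t *\<^sub>R w)"
  then show "u \<in> normal_cone K x"
  proof
    assume "\<exists>t>0. \<exists>w\<in>dual_face K x. u = - t *\<^sub>R w"
    then obtain t w where t: "t > 0" and w: "w \<in> dual_face K x" "u = - t *\<^sub>R w"
      by blast
    have "t * (w \<bullet> x) \<le> t * (w \<bullet> y)" if "y \<in> K" for y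
      using w(1) that t by (intro mult_left_mono) (auto simp: dual_face_def dest: dual_body_ge)
    then show ?thesis
      by (simp add: normal_cone_def w(2) inner_diff_right algebra_simps)
  qed (simp add: normal_cone_def)
qed

lemma dual_face_nonempty:
  assumes "origin_body K" "x extreme_point_of K"
  shows "dual_face K x \<noteq> {}"
proof -
  note K = origin_bodyD[OF assms(1)]
  have x: "x \<in> K" "x \<notin> interior K"
    using assms(2) extreme_point_not_in_interior by (auto simp: extreme_point_of_def)
  have "rel_interior K = interior K"
    using K(4) by (intro rel_interior_nonempty_interior) blast
  then obtain a where a: "a \<noteq> 0" "\<And>y. y \<in> K \<Longrightarrow> a \<bullet> x \<le> a \<bullet> y"
    using supporting_hyperplane_rel_boundary[OF K(3) x(1)] x(2) by metis
  have "- a \<noteq> 0" "\<And>y. y \<in> K \<Longrightarrow> - a \<bullet> y \<le> - a \<bullet> x"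
    using a by auto
  from normalised_support(1)[OF assms(1) this] show ?thesis
    by blast
qed

lemma inner_le_support_fun:
  assumes "compact K" "y \<in> K"
  shows "y \<bullet> u \<le> support_fun K u"
proof -
  have "compact ((\<lambda>x. x \<bullet> u) ` K)"
    by (intro compact_continuous_image continuous_intros assms)
  moreover have "{x \<bullet> u | x. x \<in> K} = (\<lambda>x. x \<bullet> u) ` K"
    by blast
  ultimately have bdd: "bdd_above {x \<bullet> u | x. x \<in> K}"
    using bounded_imp_bdd_above compact_imp_bounded by metis
  show ?thesis
    unfolding support_fun_def by (rule cSup_upper[OF _ bdd]) (use assms in blast)
qed

lemma support_line_Int_eq:
  assumes "compact K" "x \<in> K" "K \<inter> support_line K u = S" "x \<in> S"
  shows "\<And>y. y \<in> K \<Longrightarrow> y \<bullet> u \<le> x \<bullet> u" "S = {y \<in> K. y \<bullet> u = x \<bullet> u}"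
proof -
  have xu: "x \<bullet> u = support_fun K u"
    using assms by (auto simp: support_line_def)
  show "y \<bullet> u \<le> x \<bullet> u" if "y \<in> K" for y
    unfolding xu by (rule inner_le_support_fun[OF assms(1) that])
  show "S = {y \<in> K. y \<bullet> u = x \<bullet> u}"
    unfolding assms(3)[symmetric] xu by (auto simp: support_line_def)
qed

lemma support_fun_eqI:
  assumes "x \<in> K" "\<And>y. y \<in> K \<Longrightarrow> y \<bullet> u \<le> x \<bullet> u"
  shows "support_fun K u = x \<bullet> u"
  unfolding support_fun_def by (rule cSup_eq_maximum) (use assms in blast)+

text \<open>The line that exposes a point is a supporting line, hence of the form \<open>v \<bullet> w = - 1\<close> for a point
  \<open>w\<close> of the dual.\<close>

lemma exposed_point_iff:
  assumes "origin_body K"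
  shows "exposed_point K x \<longleftrightarrow> (\<exists>w\<in>dual_body K. dual_face (dual_body K) w = {x})"
proof
  note K = origin_bodyD[OF assms]
  assume "exposed_point K x"
  then obtain u where u: "u \<noteq> 0" "{x} = K \<inter> support_line K u"
    by (auto simp: exposed_point_def)
  then have x: "x \<in> K" by blast
  note s = support_line_Int_eq[OF K(1) x u(2)[symmetric] singletonI]
  have le: "u \<bullet> y \<le> u \<bullet> x" if "y \<in> K" for y
    using s(1)[OF that] by (simp add: inner_commute)
  note ns = normalised_support[OF assms u(1) le]
  have "dual_face (dual_body K) (- (1 / (u \<bullet> x)) *\<^sub>R u) = {x}"
  proof -
    have "v \<bullet> (- (1 / (u \<bullet> x)) *\<^sub>R u) = - 1 \<longleftrightarrow> v \<bullet> u = x \<bullet> u" for v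
      using ns(2) by (simp add: inner_commute[of x] divide_simps)
    then show ?thesis
      unfolding dual_face_dual_body[OF assms] using s(2) by simp
  qed
  then show "\<exists>w\<in>dual_body K. dual_face (dual_body K) w = {x}"
    using ns(1) unfolding dual_face_def by blast
next
  note K = origin_bodyD[OF assms]
  assume "\<exists>w\<in>dual_body K. dual_face (dual_body K) w = {x}"
  then obtain w where w: "w \<in> dual_body K" "{v \<in> K. v \<bullet> w = - 1} = {x}"
    unfolding dual_face_dual_body[OF assms] by blast
  then have x: "x \<in> K" "x \<bullet> w = - 1" by auto
  have ge: "v \<bullet> w \<ge> - 1" if "v \<in> K" for v
    using dual_body_ge[OF w(1) that] by simp
  have sup: "support_fun K (- w) = x \<bullet> - w"
    using x ge by (intro support_fun_eqI) fastforce+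
  have "{x} = K \<inter> support_line K (- w)"
    unfolding support_line_def sup using w(2) x(2) by auto
  moreover have "K \<inter> {v. w \<bullet> v = - 1} = {x}"
    using w(2) by (auto simp: inner_commute)
  then have "{x} face_of K"
    using face_of_Int_supporting_hyperplane_ge[OF K(3), where a = w and b = "- 1"] ge by (auto simp: inner_commute)
  moreover have "- w \<noteq> 0"
    using x(2) by auto
  ultimately show "exposed_point K x"
    unfolding exposed_point_def by blast
qed

section \<open>Smooth points, corners and polyhedral corners through dual faces\<close>

lemma aff_dim_normal_cone_eq_dim: "aff_dim (normal_cone K x) = int (dim (normal_cone K x))"
proof -
  have "0 \<in> normal_cone K x"
    by (simp add: normal_cone_def)
  then show ?thesis
    by (intro aff_dim_zero hull_inc)
qed

lemma neg_mem_normal_cone: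
  assumes "w \<in> dual_face K x"
  shows "- w \<in> normal_cone K x"
  using assms dual_body_ge(1)[of w K] by (auto simp: dual_face_def normal_cone_def inner_diff_right)

lemma dual_face_not_0:
  assumes "w \<in> dual_face K x"
  shows "w \<noteq> 0"
  using assms by (auto simp: dual_face_def)

lemma aff_dim_normal_cone_singleton:
  assumes "origin_body K" "x \<in> K" "dual_face K x = {p}"
  shows "aff_dim (normal_cone K x) = 1"
proof -
  have p: "p \<in> dual_face K x"
    using assms(3) by simp
  have "normal_cone K x \<subseteq> span {p}"
  proof
    fix u assume "u \<in> normal_cone K x"
    then consider "u = 0" | t where "u = - t *\<^sub>R p"
      using mem_normal_cone_iff[OF assms(1,2), of u] assms(3) by auto
    then show "u \<in> span {p}"
      by cases (simp_all add: span_zero span_neg span_mul span_base)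
  qed
  then have "dim (normal_cone K x) \<le> dim (span {p})"
    by (rule dim_subset)
  moreover have "dim {- p} \<le> dim (normal_cone K x)"
    using neg_mem_normal_cone[OF p] by (intro dim_subset) simp
  ultimately have "dim (normal_cone K x) = 1"
    using dual_face_not_0[OF p] by simp
  then show ?thesis
    by (simp add: aff_dim_normal_cone_eq_dim)
qed

text \<open>Two points of the conjugate face lie on a line that misses the origin.\<close>

lemma dual_face_scaled_eq:
  assumes "p \<in> dual_face K x" "q \<in> dual_face K x" "p = k *\<^sub>R q"
  shows "k = 1" "p = q"
proof -
  have "p \<bullet> x = k * (q \<bullet> x)"
    by (simp add: assms(3))
  then show "k = 1"
    using assms(1,2) by (simp add: dual_face_def)
  then show "p = q"
    using assms(3) by simp
qed

lemma aff_dim_normal_cone_two_points: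
  assumes "p \<in> dual_face K x" "q \<in> dual_face K x" "p \<noteq> q"
  shows "aff_dim (normal_cone K x) = 2"
proof -
  have "- p \<notin> span {- q}"
    using dual_face_scaled_eq(2)[OF assms(1,2)] assms(3) by (auto simp: span_singleton)
  then have "dim {- p, - q} = 2"
    using dual_face_not_0[OF assms(2)] by (simp add: dim_insert)
  moreover have "dim {- p, - q} \<le> dim (normal_cone K x)"
    using assms neg_mem_normal_cone by (intro dim_subset) auto
  moreover have "dim (normal_cone K x) \<le> 2"
    using dim_subset_UNIV[of "normal_cone K x"] by simp
  ultimately show ?thesis
    by (simp add: aff_dim_normal_cone_eq_dim)
qed

lemma aff_dim_normal_cone_cases:
  assumes "origin_body K" "x \<in> K"
  obtains "dual_face K x = {}" "aff_dim (normal_cone K x) = 0"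
  | p where "dual_face K x = {p}" "aff_dim (normal_cone K x) = 1"
  | p q where "p \<in> dual_face K x" "q \<in> dual_face K x" "p \<noteq> q" "aff_dim (normal_cone K x) = 2"
proof -
  consider "dual_face K x = {}" | p where "dual_face K x = {p}"
    | p q where "p \<in> dual_face K x" "q \<in> dual_face K x" "p \<noteq> q"
    by blast
  then show thesis
  proof cases
    case 1
    then have "normal_cone K x = {0}"
      using mem_normal_cone_iff[OF assms] by auto
    then show thesis
      using 1 that(1) by simp
  next
    case 2
    then show thesis
      using that(2) aff_dim_normal_cone_singleton[OF assms] by blast
  next
    case 3
    then show thesis
      using that(3) aff_dim_normal_cone_two_points by blast
  qed
qed

lemma smooth_extremal_point_iff:
  assumes "origin_body K"
  shows "smooth_extremal_point K x \<longleftrightarrow> x extreme_point_of K \<and> (\<exists>p. dual_face K x = {p})"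
proof (cases "x \<in> K")
  case True
  show ?thesis
    by (rule aff_dim_normal_cone_cases[OF assms True])
      (auto simp: smooth_extremal_point_def smooth_point_def face_of_singleton True)
qed (auto simp: smooth_extremal_point_def smooth_point_def extreme_point_of_def)

lemma corner_iff:
  assumes "origin_body K"
  shows "corner K x \<longleftrightarrow>
    x extreme_point_of K \<and> (\<exists>p\<in>dual_face K x. \<exists>q\<in>dual_face K x. p \<noteq> q)"
proof (cases "x \<in> K")
  case True
  show ?thesis
    by (rule aff_dim_normal_cone_cases[OF assms True])
      (auto simp: corner_def face_of_singleton)
qed (auto simp: corner_def face_of_singleton extreme_point_of_def)

lemma inner_eq_on_open_segment:
  assumes "w \<in> dual_face K x" "a \<in> K" "b \<in> K" "x \<in> open_segment a b"
  shows "w \<bullet> a = - 1 \<and> w \<bullet> b = - 1"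
proof -
  obtain l where l: "0 < l" "l < 1" "x = (1 - l) *\<^sub>R a + l *\<^sub>R b"
    using assms(4) by (auto simp: in_segment)
  have "(1 - l) * (w \<bullet> a + 1) + l * (w \<bullet> b + 1) = 0"
    using assms(1) unfolding dual_face_def l(3) by (simp add: inner_add_right algebra_simps)
  moreover have "w \<bullet> a + 1 \<ge> 0" "w \<bullet> b + 1 \<ge> 0"
    using assms dual_body_ge(1)[of w K] by (fastforce simp: dual_face_def)+
  ultimately show ?thesis
    using l by (simp add: add_nonneg_eq_0_iff)
qed

text \<open>A body has a two-dimensional normal cone only at a point through which two different
  supporting lines pass, and these meet in that point alone.\<close>

lemma extreme_point_of_two_dual_points:
  assumes "x \<in> K" "p \<in> dual_face K x" "q \<in> dual_face K x" "p \<noteq> q"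
  shows "x extreme_point_of K"
proof -
  have "a = b" if "p \<bullet> a = - 1" "p \<bullet> b = - 1" "q \<bullet> a = - 1" "q \<bullet> b = - 1" for a b
  proof (rule ccontr)
    assume "a \<noteq> b"
    define d where "d = a - b"
    have d: "p \<bullet> d = 0" "q \<bullet> d = 0" "d \<noteq> 0"
      using that \<open>a \<noteq> b\<close> by (simp_all add: d_def inner_diff_right)
    have x: "p \<bullet> x = - 1" "q \<bullet> x = - 1"
      using assms by (auto simp: dual_face_def)
    define c where "c = p $ 1 * q $ 2 - p $ 2 * q $ 1"
    have "c * d $ 1 = q $ 2 * (p \<bullet> d) - p $ 2 * (q \<bullet> d)"
      "c * d $ 2 = p $ 1 * (q \<bullet> d) - q $ 1 * (p \<bullet> d)"
      by (simp_all add: inner_2 c_def algebra_simps)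
    then have "c = 0"
      using d by (auto simp: vec2_eq_iff)
    moreover have "p $ 1 * (q \<bullet> x) - q $ 1 * (p \<bullet> x) = c * x $ 2"
      "p $ 2 * (q \<bullet> x) - q $ 2 * (p \<bullet> x) = - c * x $ 1"
      by (simp_all add: inner_2 c_def algebra_simps)
    ultimately have "p $ 1 = q $ 1" "p $ 2 = q $ 2"
      using x by simp_all
    then show False
      using assms(4) by (simp add: vec2_eq_iff)
  qed
  then have "x \<notin> open_segment a b" if "a \<in> K" "b \<in> K" for a b
    using inner_eq_on_open_segment[OF assms(2) that] inner_eq_on_open_segment[OF assms(3) that]
    by (metis open_segment_idem empty_iff)
  then show ?thesis
    using assms(1) by (auto simp: extreme_point_of_def)
qed

definition opposite_ray :: "real^2 \<Rightarrow> (real^2) set" where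
  "opposite_ray w = {- t *\<^sub>R w | t. t \<ge> 0}"

lemma opposite_ray_inj:
  assumes "p \<in> dual_face K x" "q \<in> dual_face K x" "opposite_ray p = opposite_ray q"
  shows "p = q"
proof -
  have "- p \<in> opposite_ray p"
    unfolding opposite_ray_def by (auto intro: exI[of _ "1::real"])
  then have "- p \<in> opposite_ray q"
    using assms(3) by simp
  then obtain t where "p = t *\<^sub>R q"
    by (auto simp: opposite_ray_def)
  then show ?thesis
    using dual_face_scaled_eq(2)[OF assms(1,2)] by blast
qed

lemma normal_cone_eq_Union_rays:
  assumes "origin_body K" "x \<in> K" "dual_face K x \<noteq> {}"
  shows "normal_cone K x = (\<Union>w\<in>dual_face K x. opposite_ray w)"
proof (intro set_eqI)
  fix u
  have "u \<in> normal_cone K x \<longleftrightarrow> (\<exists>w\<in>dual_face K x. \<exists>t\<ge>0. u = - t *\<^sub>R w)"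
    unfolding mem_normal_cone_iff[OF assms(1,2)]
  proof safe
    show "\<exists>w\<in>dual_face K x. \<exists>t\<ge>0. 0 = - t *\<^sub>R w"
      using assms(3) by (auto intro: exI[of _ "0::real"])
  next
    fix t :: real and w assume "w \<in> dual_face K x" "t > 0"
    then show "\<exists>w'\<in>dual_face K x. \<exists>t'\<ge>0. - t *\<^sub>R w = - t' *\<^sub>R w'"
      by (intro bexI[of _ w] exI[of _ t]) auto
  next
    fix t :: real and w
    assume "w \<in> dual_face K x" "t \<ge> 0"
      "\<not> (\<exists>s>0. \<exists>w'\<in>dual_face K x. - t *\<^sub>R w = - s *\<^sub>R w')"
    then have "t = 0"
      by (metis order_le_less)
    then show "- t *\<^sub>R w = 0"
      by simp
  qed
  then show "u \<in> normal_cone K x \<longleftrightarrow> u \<in> (\<Union>w\<in>dual_face K x. opposite_ray w)"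
    by (auto simp: opposite_ray_def)
qed

lemma dual_face_face_of:
  assumes "origin_body K" "x \<in> K"
  shows "dual_face K x face_of dual_body K"
proof -
  have "dual_body K \<inter> {w. x \<bullet> w = - 1} face_of dual_body K"
    using origin_bodyD(3)[OF origin_body_dual[OF assms(1)]] dual_body_ge(2)[OF _ assms(2)]
    by (intro face_of_Int_supporting_hyperplane_ge) auto
  moreover have "dual_body K \<inter> {w. x \<bullet> w = - 1} = dual_face K x"
    by (auto simp: dual_face_def inner_commute)
  ultimately show ?thesis
    by simp
qed

lemma dual_face_eq_segment:
  assumes "origin_body K" "x \<in> K" "dual_face K x \<noteq> {}"
  obtains a b where "dual_face K x = closed_segment a b"
proof -
  note D = origin_bodyD[OF origin_body_dual[OF assms(1)]]
  have face: "dual_face K x face_of dual_body K"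
    by (rule dual_face_face_of[OF assms(1,2)])
  have "x \<noteq> 0"
    using assms(3) by (auto simp: dual_face_def)
  then have "aff_dim {w. x \<bullet> w = - 1} = 1"
    by simp
  moreover have "dual_face K x \<subseteq> {w. x \<bullet> w = - 1}"
    by (auto simp: dual_face_def inner_commute)
  ultimately have "collinear (dual_face K x)"
    unfolding collinear_aff_dim by (metis aff_dim_subset)
  then show thesis
    using that compact_convex_collinear_segment[OF assms(3)
        face_of_imp_compact[OF D(3,1) face] face_of_imp_convex[OF face]]
    by metis
qed

text \<open>The normal cone is the cone over the negated conjugate face, a convex set on a line off the
  origin. Hence its extreme rays are the rays over the extreme points of that face.\<close>

lemma opposite_ray_face_of_normal_cone:
  assumes "origin_body K" "x \<in> K" "w \<in> dual_face K x" "w extreme_point_of dual_body K"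
  shows "opposite_ray w face_of normal_cone K x"
  unfolding face_of_def
proof (intro conjI ballI impI)
  have ne: "dual_face K x \<noteq> {}"
    using assms(3) by blast
  note N = normal_cone_eq_Union_rays[OF assms(1,2) ne]
  show "opposite_ray w \<subseteq> normal_cone K x"
    unfolding N using assms(3) by blast
  show "convex (opposite_ray w)"
  proof -
    have "opposite_ray w = (\<lambda>t. t *\<^sub>R (- w)) ` {0..}"
      by (auto simp: opposite_ray_def)
    moreover have "convex ((\<lambda>t. t *\<^sub>R (- w)) ` {0..})"
      by (intro convex_linear_image linear_scaleR_left) auto
    ultimately show ?thesis by simp
  qed
  fix a b u
  assume a: "a \<in> normal_cone K x" and b: "b \<in> normal_cone K x"
    and u: "u \<in> opposite_ray w" "u \<in> open_segment a b"
  obtain s w1 where s: "s \<ge> 0" "w1 \<in> dual_face K x" "a = - s *\<^sub>R w1"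
    using a unfolding N opposite_ray_def by blast
  obtain t w2 where t: "t \<ge> 0" "w2 \<in> dual_face K x" "b = - t *\<^sub>R w2"
    using b unfolding N opposite_ray_def by blast
  obtain r where r: "r \<ge> 0" "u = - r *\<^sub>R w"
    using u(1) by (auto simp: opposite_ray_def)
  obtain l where l: "0 < l" "l < 1" "u = (1 - l) *\<^sub>R a + l *\<^sub>R b"
    using u(2) by (auto simp: in_segment)
  define m n where "m = (1 - l) * s" and "n = l * t"
  have mn: "m \<ge> 0" "n \<ge> 0"
    using s t l by (auto simp: m_def n_def)
  have eq: "r *\<^sub>R w = m *\<^sub>R w1 + n *\<^sub>R w2"
    using r(2) l(3) unfolding s(3) t(3) by (simp add: m_def n_def algebra_simps)
  have "r * (w \<bullet> x) = m * (w1 \<bullet> x) + n * (w2 \<bullet> x)"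
    using arg_cong[OF eq, of "\<lambda>v. v \<bullet> x"] by (simp add: inner_add_left)
  then have sum: "r = m + n"
    using assms(3) s(2) t(2) by (simp add: dual_face_def)
  have "w1 = w \<and> w2 = w" if "m \<noteq> 0" "n \<noteq> 0"
  proof -
    have pos: "m > 0" "n > 0" "r > 0"
      using that mn sum by auto
    have "w = (1 / r) *\<^sub>R (r *\<^sub>R w)"
      using pos by simp
    also have "\<dots> = (m / r) *\<^sub>R w1 + (n / r) *\<^sub>R w2"
      unfolding eq by (simp add: algebra_simps)
    also have "m / r = 1 - n / r"
      using pos sum by (simp add: field_simps)
    finally have w: "w = (1 - n / r) *\<^sub>R w1 + (n / r) *\<^sub>R w2" .
    have "w1 = w2"
    proof (rule ccontr)
      assume "w1 \<noteq> w2"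
      moreover have "0 < n / r" "n / r < 1"
        using pos sum by auto
      ultimately have "w \<in> open_segment w1 w2"
        using w by (auto simp: in_segment)
      then show False
        using assms(4) s(2) t(2) by (auto simp: extreme_point_of_def dual_face_def)
    qed
    then show ?thesis
      using w by (simp add: algebra_simps)
  qed
  moreover have "w2 = w" if "m = 0" "n \<noteq> 0"
    using eq that sum by simp
  moreover have "w1 = w" if "n = 0" "m \<noteq> 0"
    using eq that sum by simp
  moreover have "s = 0" if "m = 0"
    using that l by (simp add: m_def)
  moreover have "t = 0" if "n = 0"
    using that l by (simp add: n_def)
  ultimately have "s = 0 \<or> w1 = w" "t = 0 \<or> w2 = w"
    by blast+
  then show "a \<in> opposite_ray w" "b \<in> opposite_ray w"
    using s t by (auto simp: opposite_ray_def intro: exI[of _ "0::real"])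
qed

lemma aff_dim_opposite_ray:
  assumes "w \<noteq> 0"
  shows "aff_dim (opposite_ray w) = 1"
proof -
  have mem: "0 \<in> opposite_ray w" "- w \<in> opposite_ray w"
    unfolding opposite_ray_def by (auto intro: exI[of _ "0::real"] exI[of _ "1::real"])
  have "opposite_ray w \<subseteq> span {w}"
    by (auto simp: opposite_ray_def span_singleton simp del: scaleR_minus_left)
  then have "dim (opposite_ray w) \<le> dim (span {w})"
    by (rule dim_subset)
  moreover have "dim {- w} \<le> dim (opposite_ray w)"
    using mem by (intro dim_subset) simp
  ultimately have "dim (opposite_ray w) = 1"
    using assms by simp
  then show ?thesis
    using mem(1) by (simp add: aff_dim_zero hull_inc)
qed

lemma face_of_normal_cone_is_ray:
  assumes "origin_body K" "x \<in> K" "r face_of normal_cone K x" "aff_dim r = 1"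
  shows "\<exists>w\<in>dual_face K x. w extreme_point_of dual_body K \<and> r = opposite_ray w"
proof -
  have "\<not> r \<subseteq> {0}"
    using aff_dim_subset[of r "{0}"] assms(4) by auto
  then obtain u where u: "u \<in> r" "u \<noteq> 0"
    by blast
  have rN: "r \<subseteq> normal_cone K x"
    using assms(3) by (rule face_of_imp_subset)
  then obtain t w where tw: "t > 0" "w \<in> dual_face K x" "u = - t *\<^sub>R w"
    using mem_normal_cone_iff[OF assms(1,2), of u] u by blast
  have ne: "dual_face K x \<noteq> {}"
    using tw(2) by blast
  note N = normal_cone_eq_Union_rays[OF assms(1,2) ne]
  have end_mem: "a \<in> r \<and> b \<in> r"
    if "c \<in> open_segment a b" "c \<in> r" "a \<in> normal_cone K x" "b \<in> normal_cone K x" for a b c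
    using assms(3) that unfolding face_of_def by blast
  have "opposite_ray w \<subseteq> normal_cone K x"
    unfolding N using tw(2) by blast
  then have rayN: "- s *\<^sub>R w \<in> normal_cone K x" if "s \<ge> 0" for s
    using that by (auto simp: opposite_ray_def)
  have far: "0 \<in> r \<and> - s *\<^sub>R w \<in> r" if "s > t" for s
  proof (rule end_mem)
    show "u \<in> open_segment 0 (- s *\<^sub>R w)"
      using that tw dual_face_not_0[OF tw(2)] by (auto simp: in_segment intro!: exI[of _ "t / s"])
  qed (use u rayN[of 0] rayN[of s] that tw(1) in auto)
  have zero: "0 \<in> r"
    using far[of "t + 1"] by simp
  have "convex r"
    using assms(3) by (rule face_of_imp_convex)
  have "opposite_ray w \<subseteq> r"
  proof
    fix v assume "v \<in> opposite_ray w"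
    then obtain s where s: "s \<ge> 0" "v = - s *\<^sub>R w"
      by (auto simp: opposite_ray_def)
    define m where "m = s + t + 1"
    have m: "m > t" "m > 0" "s \<le> m"
      using s(1) tw(1) by (auto simp: m_def)
    have "(1 - s / m) *\<^sub>R 0 + (s / m) *\<^sub>R (- m *\<^sub>R w) \<in> r"
      using far[OF m(1)] m s(1) by (intro convexD[OF \<open>convex r\<close>]) auto
    then show "v \<in> r"
      using m by (simp add: s(2))
  qed
  moreover have "r \<subseteq> opposite_ray w"
  proof
    fix v assume v: "v \<in> r"
    have "dim r = 1"
      using assms(4) zero by (simp add: aff_dim_zero hull_inc)
    moreover have "dim {v, u} \<le> dim r"
      using u v by (intro dim_subset) auto
    ultimately have "v \<in> span {u}"
      using u(2) by (auto simp: dim_insert split: if_splits)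
    then obtain k where k: "v = (- k) *\<^sub>R w"
      unfolding span_singleton tw(3) by force
    have "v \<in> normal_cone K x"
      using v rN by blast
    then obtain m w' where m: "m \<ge> 0" "w' \<in> dual_face K x" "v = - m *\<^sub>R w'"
      unfolding N opposite_ray_def by blast
    have "k * (w \<bullet> x) = m * (w' \<bullet> x)"
      using arg_cong[OF trans[OF k[symmetric] m(3)], of "\<lambda>v. v \<bullet> x"] by simp
    then have "k \<ge> 0"
      using m(1,2) tw(2) by (simp add: dual_face_def)
    then show "v \<in> opposite_ray w"
      using k by (auto simp: opposite_ray_def)
  qed
  ultimately have ray: "r = opposite_ray w"
    by blast
  have "w extreme_point_of dual_face K x"
    unfolding extreme_point_of_def
  proof (intro conjI ballI notI)
    fix w1 w2
    assume w12: "w1 \<in> dual_face K x" "w2 \<in> dual_face K x" "w \<in> open_segment w1 w2"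
    then obtain l where l: "0 < l" "l < 1" "w = (1 - l) *\<^sub>R w1 + l *\<^sub>R w2" "w1 \<noteq> w2"
      by (auto simp: in_segment)
    have "- w \<in> open_segment (- w1) (- w2)"
      unfolding in_segment using l by (auto intro!: exI[of _ l])
    moreover have "- w \<in> r"
      unfolding ray opposite_ray_def by (auto intro: exI[of _ "1::real"])
    ultimately have "- w1 \<in> r \<and> - w2 \<in> r"
      using end_mem neg_mem_normal_cone w12 by blast
    then obtain m n where "w1 = m *\<^sub>R w" "w2 = n *\<^sub>R w"
      unfolding ray opposite_ray_def by auto
    then have "w1 = w" "w2 = w"
      using dual_face_scaled_eq(2) w12(1,2) tw(2) by blast+
    then show False
      using l(4) by simp
  qed (rule tw(2))
  then have "w extreme_point_of dual_body K"
    using extreme_point_of_face[OF dual_face_face_of[OF assms(1,2)]] by blast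
  then show ?thesis
    using ray tw(2) by blast
qed

lemma normal_cone_eq_opposite_ray_iff:
  assumes "origin_body K" "x \<in> K" "p \<in> dual_face K x" "y \<in> K"
  shows "normal_cone K y = opposite_ray p \<longleftrightarrow> dual_face K y = {p}"
proof
  assume N: "normal_cone K y = opposite_ray p"
  have p: "p \<in> dual_body K" "p \<bullet> x = - 1"
    using assms(3) by (auto simp: dual_face_def)
  have "- p \<in> normal_cone K y"
    unfolding N opposite_ray_def by (auto intro: exI[of _ "1::real"])
  then obtain t w where tw: "t > 0" "w \<in> dual_face K y" "p = t *\<^sub>R w"
    using mem_normal_cone_iff[OF assms(1,4), of "- p"] dual_face_not_0[OF assms(3)] by auto
  have "w \<bullet> x \<ge> - 1"
    using tw(2) assms(2) dual_body_ge(1) by (auto simp: dual_face_def)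
  moreover have "t * (w \<bullet> x) = - 1"
    using p(2) by (simp add: tw(3))
  ultimately have "t \<ge> 1"
    using mult_left_mono[of "- 1" "w \<bullet> x" t] tw(1) by simp
  have "t * (w \<bullet> y) \<ge> - 1"
    using dual_body_ge(1)[OF p(1) assms(4)] by (simp add: tw(3))
  then have "t \<le> 1"
    using tw(2) by (simp add: dual_face_def)
  then have "p \<in> dual_face K y"
    using tw \<open>t \<ge> 1\<close> by simp
  moreover have "w' = p" if "w' \<in> dual_face K y" for w'
  proof -
    have "- w' \<in> opposite_ray p"
      using neg_mem_normal_cone[OF that] N by simp
    then obtain s where "w' = s *\<^sub>R p"
      by (auto simp: opposite_ray_def)
    then show ?thesis
      using dual_face_scaled_eq(2) that \<open>p \<in> dual_face K y\<close> by blast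
  qed
  ultimately show "dual_face K y = {p}"
    by blast
next
  assume "dual_face K y = {p}"
  then show "normal_cone K y = opposite_ray p"
    using normal_cone_eq_Union_rays[OF assms(1,4)] by simp
qed

text \<open>The two extreme rays of the normal cone lie over the ends of the conjugate segment, and the ray
  over an end is a normal cone of \<open>K\<close> just when this end exhausts some conjugate face. This turns the
  condition on the corner into exposedness of two points of the dual.\<close>

lemma polyhedral_corner_iff:
  assumes "origin_body K" "corner K x"
  shows "polyhedral_corner K x \<longleftrightarrow>
    (\<forall>p\<in>dual_face K x. p extreme_point_of dual_body K \<longrightarrow> (\<exists>y\<in>K. dual_face K y = {p}))"
proof -
  have x: "x \<in> K"
    using assms(2) by (auto simp: corner_def face_of_singleton extreme_point_of_def)
  obtain p q where pq: "p \<in> dual_face K x" "q \<in> dual_face K x" "p \<noteq> q"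
    using assms corner_iff by blast
  then obtain a b where ab: "dual_face K x = closed_segment a b"
    using dual_face_eq_segment[OF assms(1) x] by blast
  have "a \<noteq> b"
    using pq ab by auto
  have mem: "a \<in> dual_face K x" "b \<in> dual_face K x"
    unfolding ab by simp_all
  have ext: "p \<in> dual_face K x \<and> p extreme_point_of dual_body K \<longleftrightarrow> p \<in> {a, b}" for p
    using extreme_point_of_face[OF dual_face_face_of[OF assms(1) x], of p]
      extreme_point_of_segment[of p a b] by (auto simp: ab)
  have faces: "{r. r face_of normal_cone K x \<and> aff_dim r = 1} = {opposite_ray a, opposite_ray b}"
  proof (intro equalityI subsetI)
    fix r assume "r \<in> {r. r face_of normal_cone K x \<and> aff_dim r = 1}"
    then obtain w where "w \<in> dual_face K x \<and> w extreme_point_of dual_body K" "r = opposite_ray w"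
      using face_of_normal_cone_is_ray[OF assms(1) x] by blast
    then show "r \<in> {opposite_ray a, opposite_ray b}"
      using ext[of w] by auto
  next
    fix r assume "r \<in> {opposite_ray a, opposite_ray b}"
    then obtain w where w: "w \<in> {a, b}" "r = opposite_ray w"
      by blast
    then show "r \<in> {r. r face_of normal_cone K x \<and> aff_dim r = 1}"
      using ext[of w] opposite_ray_face_of_normal_cone[OF assms(1) x, of w]
        aff_dim_opposite_ray[of w] dual_face_not_0[of w K x] by blast
  qed
  have "opposite_ray a \<noteq> opposite_ray b"
    using opposite_ray_inj mem \<open>a \<noteq> b\<close> by blast
  have cones: "opposite_ray w \<in> normal_cones K \<longleftrightarrow> (\<exists>y\<in>K. dual_face K y = {w})"
    if "w \<in> dual_face K x" for w
  proof -
    have "opposite_ray w \<noteq> UNIV"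
      using aff_dim_opposite_ray[OF dual_face_not_0[OF that]] by auto
    then show ?thesis
      using normal_cone_eq_opposite_ray_iff[OF assms(1) x that] by (auto simp: normal_cones_def)
  qed
  have "polyhedral_corner K x \<longleftrightarrow>
      opposite_ray a \<in> normal_cones K \<and> opposite_ray b \<in> normal_cones K"
    unfolding polyhedral_corner_def faces
    using assms(2) \<open>opposite_ray a \<noteq> opposite_ray b\<close> by (auto simp: doubleton_eq_iff)
  also have "\<dots> \<longleftrightarrow> (\<forall>p\<in>{a, b}. \<exists>y\<in>K. dual_face K y = {p})"
    using cones mem by simp
  finally show ?thesis
    using ext by blast
qed

section \<open>Bodies without non-exposed points\<close>

lemma no_nonexposed_point_iff:
  assumes "origin_body K"
  shows "(\<nexists>x. nonexposed_point K x) \<longleftrightarrow>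
    (\<forall>x. x extreme_point_of K \<longrightarrow> (\<exists>w\<in>dual_body K. dual_face (dual_body K) w = {x}))"
  by (simp add: nonexposed_point_def exposed_point_iff[OF assms] face_of_singleton)

text \<open>An extreme point of the dual lies in the conjugate face of some boundary point of the body. If
  that face is more than a point, the boundary point is a corner, and its being polyhedral makes the end
  points of the face exposed.\<close>

lemma no_nonexposed_point_dual:
  assumes "origin_body K" "\<forall>x. corner K x \<longrightarrow> polyhedral_corner K x"
  shows "\<nexists>p. nonexposed_point (dual_body K) p"
  unfolding no_nonexposed_point_iff[OF origin_body_dual[OF assms(1)]]
    dual_body_dual_body[OF assms(1)]
proof (intro allI impI)
  fix p assume p: "p extreme_point_of dual_body K"
  obtain x where x: "x \<in> K" "x \<bullet> p = - 1"
    using dual_face_nonempty[OF origin_body_dual[OF assms(1)] p]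
    unfolding dual_face_dual_body[OF assms(1)] by blast
  have pF: "p \<in> dual_face K x"
    using p x(2) by (simp add: dual_face_def extreme_point_of_def inner_commute)
  show "\<exists>y\<in>K. dual_face K y = {p}"
  proof (cases "dual_face K x = {p}")
    case False
    then obtain q where q: "q \<in> dual_face K x" "p \<noteq> q"
      using pF by blast
    then have "corner K x"
      using corner_iff[OF assms(1)] extreme_point_of_two_dual_points x(1) pF by blast
    then show ?thesis
      using polyhedral_corner_iff[OF assms(1)] assms(2) pF p by blast
  qed (use x(1) in blast)
qed

lemma eventually_near_in_open:
  fixes x a :: "'a::real_normed_vector"
  assumes "open U" "x \<in> U"
  shows "eventually (\<lambda>e. x + e *\<^sub>R (a - x) \<in> U) (at_right 0)"
proof (rule topological_tendstoD)
  show "((\<lambda>e. x + e *\<^sub>R (a - x)) \<longlongrightarrow> x) (at_right 0)"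
    by (rule tendsto_eq_intros refl | simp)+
qed (rule assms)+

text \<open>Being extreme or exposed depends only on the body near the point: by convexity, a chord or a
  violation of a supporting inequality can be shrunk towards the point.\<close>

lemma extreme_point_of_local:
  fixes K L :: "'a::real_normed_vector set"
  assumes "x extreme_point_of L" "convex K" "open U" "x \<in> U" "K \<inter> U = L \<inter> U"
  shows "x extreme_point_of K"
proof -
  have xK: "x \<in> K"
    using assms by (auto simp: extreme_point_of_def)
  have "x \<notin> open_segment a b" if ab: "a \<in> K" "b \<in> K" for a b
  proof
    assume "x \<in> open_segment a b"
    then obtain l where l: "a \<noteq> b" "0 < l" "l < 1" "x = (1 - l) *\<^sub>R a + l *\<^sub>R b"
      by (auto simp: in_segment)
    have "eventually (\<lambda>e. x + e *\<^sub>R (a - x) \<in> U \<and> x + e *\<^sub>R (b - x) \<in> U \<and> e \<in> {0<..<1})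
        (at_right (0::real))"
      by (intro eventually_conj eventually_near_in_open[OF assms(3,4)] eventually_at_right_real) simp
    then obtain e where e: "x + e *\<^sub>R (a - x) \<in> U" "x + e *\<^sub>R (b - x) \<in> U" "0 < e" "e < 1"
      using eventually_happens'[OF trivial_limit_at_right_real] by force
    define c d where "c = x + e *\<^sub>R (a - x)" and "d = x + e *\<^sub>R (b - x)"
    have mem: "x + e *\<^sub>R (z - x) \<in> K" if "z \<in> K" for z
      using convexD[OF assms(2) xK that, of "1 - e" e] e by (simp add: algebra_simps)
    have "c \<in> L" "d \<in> L"
      using mem ab e assms(5) by (auto simp: c_def d_def)
    moreover have "x \<in> open_segment c d"
      unfolding in_segment
    proof (intro conjI exI[of _ l])
      show "c \<noteq> d"
        using l e by (simp add: c_def d_def)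
      have "(1 - l) *\<^sub>R c + l *\<^sub>R d = (1 - e) *\<^sub>R x + e *\<^sub>R ((1 - l) *\<^sub>R a + l *\<^sub>R b)"
        by (simp add: c_def d_def algebra_simps)
      also have "\<dots> = x"
        unfolding l(4)[symmetric] by (simp add: algebra_simps)
      finally show "x = (1 - l) *\<^sub>R c + l *\<^sub>R d"
        by (rule sym)
    qed (use l in auto)
    ultimately show False
      using assms(1) by (auto simp: extreme_point_of_def)
  qed
  then show ?thesis
    using xK by (auto simp: extreme_point_of_def)
qed

lemma exposed_local:
  assumes "w \<in> dual_body K" "{v \<in> K. v \<bullet> w = - 1} = {x}"
    and "convex L" "open U" "x \<in> U" "K \<inter> U = L \<inter> U"
  shows "w \<in> dual_body L" "{v \<in> L. v \<bullet> w = - 1} = {x}"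
proof -
  have x: "x \<in> K" "x \<in> L" "x \<bullet> w = - 1"
    using assms by auto
  have *: "v = x" if v: "v \<in> L" "v \<bullet> w \<le> - 1" for v
  proof -
    have "eventually (\<lambda>e. x + e *\<^sub>R (v - x) \<in> U \<and> e \<in> {0<..<1}) (at_right (0::real))"
      by (intro eventually_conj eventually_near_in_open[OF assms(4,5)] eventually_at_right_real) simp
    then obtain e where e: "x + e *\<^sub>R (v - x) \<in> U" "0 < e" "e < 1"
      using eventually_happens'[OF trivial_limit_at_right_real] by force
    have "x + e *\<^sub>R (v - x) \<in> L"
      using convexD[OF assms(3) x(2) v(1), of "1 - e" e] e by (simp add: algebra_simps)
    then have K: "x + e *\<^sub>R (v - x) \<in> K"
      using e(1) assms(6) by blast
    have "(x + e *\<^sub>R (v - x)) \<bullet> w = - 1 + e * (v \<bullet> w + 1)"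
      by (simp add: inner_add_left inner_diff_left x(3))
    moreover have "e * (v \<bullet> w + 1) \<le> 0"
      using v(2) e(2) by (simp add: mult_nonneg_nonpos)
    ultimately have "(x + e *\<^sub>R (v - x)) \<bullet> w = - 1"
      using dual_body_ge(2)[OF assms(1) K] by simp
    then have "x + e *\<^sub>R (v - x) = x"
      using K assms(2) by blast
    then show ?thesis
      using e(2) by simp
  qed
  show "w \<in> dual_body L"
  proof (rule dual_bodyI)
    fix v assume "v \<in> L"
    then show "w \<bullet> v \<ge> - 1"
      using *[of v] x(3) by (cases "v \<bullet> w \<le> - 1") (auto simp: inner_commute)
  qed
  have "v = x" if "v \<in> L" "v \<bullet> w = - 1" for v
    using *[of v] that by simp
  then show "{v \<in> L. v \<bullet> w = - 1} = {x}"
    using x by blast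
qed

section \<open>Gluing along the horizontal axis\<close>

text \<open>The conditions on the radial and support functions in coordinates: the horizontal chord
  through the origin ends at the extreme abscissas \<open>- c\<close> and \<open>a\<close> of \<open>K\<close>, and \<open>a * c = 1\<close>. The last
  equation makes the property invariant under duality.\<close>

definition axis_strip :: "(real^2) set \<Rightarrow> real \<Rightarrow> real \<Rightarrow> bool" where
  "axis_strip K a c \<longleftrightarrow> a > 0 \<and> c > 0 \<and> a * c = 1 \<and> a *\<^sub>R e1 \<in> K \<and> - c *\<^sub>R e1 \<in> K \<and>
    (\<forall>v\<in>K. - c \<le> v $ 1 \<and> v $ 1 \<le> a)"

definition glue :: "(real^2) set \<Rightarrow> (real^2) set" where
  "glue K = (K \<inter> upper_half) \<union> (dual_body K \<inter> lower_half)"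

lemma mem_glue:
  "v \<in> glue K \<longleftrightarrow> v \<in> K \<and> v $ 2 \<ge> 0 \<or> v \<in> dual_body K \<and> v $ 2 \<le> 0"
  by (auto simp: glue_def upper_half_def lower_half_def)

lemma axis_strip_dual:
  assumes "axis_strip K a c"
  shows "axis_strip (dual_body K) a c"
proof -
  have ac: "a > 0" "c > 0" "a * c = 1" and mem: "a *\<^sub>R e1 \<in> K" "- c *\<^sub>R e1 \<in> K"
    and strip: "\<And>v. v \<in> K \<Longrightarrow> - c \<le> v $ 1 \<and> v $ 1 \<le> a"
    using assms by (auto simp: axis_strip_def)
  have "a *\<^sub>R e1 \<in> dual_body K"
  proof (rule dual_bodyI)
    fix v assume "v \<in> K"
    then have "a * v $ 1 \<ge> a * (- c)"
      using ac strip by (intro mult_left_mono) auto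
    then show "a *\<^sub>R e1 \<bullet> v \<ge> - 1"
      using ac by (simp add: inner_2)
  qed
  moreover have "- c *\<^sub>R e1 \<in> dual_body K"
  proof (rule dual_bodyI)
    fix v assume "v \<in> K"
    then have "c * v $ 1 \<le> c * a"
      using ac strip by (intro mult_left_mono) auto
    then show "- c *\<^sub>R e1 \<bullet> v \<ge> - 1"
      using ac by (simp add: inner_2 mult.commute)
  qed
  moreover have "- c \<le> w $ 1 \<and> w $ 1 \<le> a" if w: "w \<in> dual_body K" for w
  proof -
    have "a * w $ 1 \<ge> a * (- c)" "c * w $ 1 \<le> c * a"
      using dual_body_ge(1)[OF w mem(1)] dual_body_ge(1)[OF w mem(2)] ac
      by (simp_all add: inner_2 mult.commute)
    then show ?thesis
      using ac by (simp_all only: mult_le_cancel_left_pos)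
  qed
  ultimately show ?thesis
    using ac by (simp add: axis_strip_def)
qed

lemma axis_strip_glue:
  assumes "axis_strip K a c"
  shows "axis_strip (glue K) a c"
  using assms axis_strip_dual[OF assms] by (auto simp: axis_strip_def mem_glue)

lemma axis_strip_prod_ge:
  assumes "axis_strip K a c" "axis_strip M a c" "u \<in> K" "v \<in> M"
  shows "u $ 1 * v $ 1 \<ge> - 1"
proof -
  have ac: "a > 0" "c > 0" "a * c = 1"
    and uv: "- c \<le> u $ 1" "u $ 1 \<le> a" "- c \<le> v $ 1" "v $ 1 \<le> a"
    using assms by (auto simp: axis_strip_def)
  consider "u $ 1 \<ge> 0" "v $ 1 \<ge> 0" | "u $ 1 \<le> 0" "v $ 1 \<le> 0"
    | "u $ 1 \<ge> 0" "v $ 1 \<le> 0" | "u $ 1 \<le> 0" "v $ 1 \<ge> 0"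
    by linarith
  then show ?thesis
  proof cases
    case 3
    then have "u $ 1 * (- v $ 1) \<le> a * c"
      using uv ac by (intro mult_mono) auto
    then show ?thesis using ac by simp
  next
    case 4
    then have "(- u $ 1) * v $ 1 \<le> c * a"
      using uv ac by (intro mult_mono) auto
    then show ?thesis using ac by (simp add: mult.commute)
  qed (auto intro: order_trans[of _ 0] mult_nonneg_nonneg mult_nonpos_nonpos)
qed

text \<open>Points of opposite half planes are tested against each other in the duality of \<open>K\<close> and its
  dual; for points of the same half plane the product of the ordinates has the favourable sign, and
  the strip condition bounds the product of the abscissas.\<close>

lemma dual_body_glue:
  assumes "origin_body K" "axis_strip K a c"
  shows "dual_body (glue K) = glue K"
proof
  note D = axis_strip_dual[OF assms(2)]
  have same_side: "u \<bullet> v \<ge> - 1" if "u $ 1 * v $ 1 \<ge> - 1" "u $ 2 * v $ 2 \<ge> 0" for u v :: "real^2"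
    using that by (simp add: inner_2)
  show "glue K \<subseteq> dual_body (glue K)"
  proof (intro subsetI dual_bodyI)
    fix u v assume uv: "u \<in> glue K" "v \<in> glue K"
    then have "u $ 1 * v $ 1 \<ge> - 1"
      using axis_strip_prod_ge axis_strip_glue[OF assms(2)] by blast
    then show "u \<bullet> v \<ge> - 1"
      using uv dual_body_ge same_side[of u v] unfolding mem_glue
      by (metis mult_nonneg_nonneg mult_nonpos_nonpos)
  qed
  show "dual_body (glue K) \<subseteq> glue K"
  proof
    fix u assume u: "u \<in> dual_body (glue K)"
    note uD = axis_strip_dual[OF axis_strip_glue[OF assms(2)]]
    show "u \<in> glue K"
    proof (cases "u $ 2 \<ge> 0")
      case True
      have "u \<in> dual_body (dual_body K)"
      proof (rule dual_bodyI)
        fix w assume w: "w \<in> dual_body K"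
        show "u \<bullet> w \<ge> - 1"
        proof (cases "w $ 2 \<ge> 0")
          case above: True
          show ?thesis
            using same_side[OF axis_strip_prod_ge[OF uD D u w]] True above by simp
        next
          case False
          then have "w \<in> glue K"
            using w by (simp add: mem_glue)
          then show ?thesis
            using u dual_body_ge by blast
        qed
      qed
      then show ?thesis
        using True dual_body_dual_body[OF assms(1)] by (simp add: mem_glue)
    next
      case False
      have "u \<in> dual_body K"
      proof (rule dual_bodyI)
        fix w assume w: "w \<in> K"
        show "u \<bullet> w \<ge> - 1"
        proof (cases "w $ 2 \<ge> 0")
          case True
          then have "w \<in> glue K"
            using w by (simp add: mem_glue)
          then show ?thesis
            using u dual_body_ge by blast
        next
          case below: False
          have "u $ 2 * w $ 2 \<ge> 0"
            using False below by (intro mult_nonpos_nonpos) linarith+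
          then show ?thesis
            using same_side axis_strip_prod_ge[OF uD assms(2) u w] by blast
        qed
      qed
      then show ?thesis
        using False by (simp add: mem_glue)
    qed
  qed
qed

text \<open>Closedness and convexity come from self-duality, since every dual is closed and convex.\<close>

lemma origin_body_glue:
  assumes "origin_body K" "axis_strip K a c"
  shows "origin_body (glue K)"
proof -
  note K = origin_bodyD[OF assms(1)] and D = origin_bodyD[OF origin_body_dual[OF assms(1)]]
  have "convex (glue K)" "closed (glue K)"
    using convex_dual_body[of "glue K"] closed_dual_body[of "glue K"] dual_body_glue[OF assms]
    by simp_all
  moreover have "bounded (glue K)"
    by (rule bounded_subset[of "K \<union> dual_body K"])
      (use K(1) D(1) in \<open>auto simp: mem_glue compact_imp_bounded\<close>)
  moreover have "0 \<in> interior (glue K)"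
  proof -
    have "K \<inter> dual_body K \<subseteq> glue K"
      by (auto simp: mem_glue)
    then have "interior K \<inter> interior (dual_body K) \<subseteq> interior (glue K)"
      by (metis interior_Int interior_mono)
    then show ?thesis
      using K(4) D(4) by blast
  qed
  ultimately show ?thesis
    by (simp add: origin_body_def convex_body_def compact_eq_bounded_closed)
qed

section \<open>The two points on the axis\<close>

text \<open>The two ends of the axis chord enter the argument symmetrically; \<open>p\<close> stands for one of them
  and \<open>q\<close> for the other. The vertical line through \<open>p\<close> is the line conjugate to \<open>q\<close>.\<close>

definition axis_pair :: "real^2 \<Rightarrow> real^2 \<Rightarrow> bool" where
  "axis_pair p q \<longleftrightarrow> p $ 2 = 0 \<and> q $ 2 = 0 \<and> p \<bullet> q = - 1"

lemma axis_pair_sym: "axis_pair p q \<Longrightarrow> axis_pair q p"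
  by (auto simp: axis_pair_def inner_commute)

lemma axis_pair_line:
  assumes "axis_pair p q"
  shows "v \<bullet> q = - 1 \<longleftrightarrow> v $ 1 = p $ 1"
proof -
  have *: "p $ 1 * q $ 1 = - 1"
    using assms by (auto simp: axis_pair_def inner_2)
  then have "q $ 1 \<noteq> 0"
    by auto
  moreover have "v \<bullet> q = v $ 1 * q $ 1"
    using assms by (simp add: axis_pair_def inner_2)
  ultimately show ?thesis
    unfolding *[symmetric] by simp
qed

text \<open>A chord through \<open>p\<close> in the supporting line has an end in either closed half plane.\<close>

lemma extreme_point_of_one_sided:
  assumes "axis_pair p q" "p \<in> K" "q \<in> dual_body K"
    and side: "\<And>v. v \<in> K \<Longrightarrow> v \<bullet> q = - 1 \<Longrightarrow> s * v $ 2 \<ge> 0 \<Longrightarrow> v = p"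
  shows "p extreme_point_of K"
proof -
  have "p \<notin> open_segment a b" if ab: "a \<in> K" "b \<in> K" for a b
  proof
    assume seg: "p \<in> open_segment a b"
    have "q \<in> dual_face K p"
      using assms(1,3) by (simp add: dual_face_def axis_pair_def inner_commute)
    from inner_eq_on_open_segment[OF this ab seg] have eq: "a \<bullet> q = - 1" "b \<bullet> q = - 1"
      by (simp_all add: inner_commute)
    obtain l where l: "0 < l" "l < 1" "p = (1 - l) *\<^sub>R a + l *\<^sub>R b"
      using seg by (auto simp: in_segment)
    have "(1 - l) * a $ 2 + l * b $ 2 = 0"
      using assms(1) arg_cong[OF l(3), of "\<lambda>v. v $ 2"] by (simp add: axis_pair_def)
    moreover have "(1 - l) * (s * a $ 2) + l * (s * b $ 2) = s * ((1 - l) * a $ 2 + l * b $ 2)"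
      by (simp add: algebra_simps)
    ultimately have "(1 - l) * (s * a $ 2) + l * (s * b $ 2) = 0"
      by simp
    then have "s * a $ 2 \<ge> 0 \<or> s * b $ 2 \<ge> 0"
      using mult_pos_neg[of "1 - l" "s * a $ 2"] mult_pos_neg[of l "s * b $ 2"] l(1,2) by linarith
    then have "a = p \<or> b = p"
      using side ab eq by blast
    then show False
      using seg by (auto simp: open_segment_def)
  qed
  then show ?thesis
    using assms(2) by (auto simp: extreme_point_of_def)
qed

text \<open>If the upper half of \<open>K\<close> touches the line at \<open>p\<close> only in \<open>p\<close>, and the lower half of the dual
  touches the line at \<open>q\<close> only in \<open>q\<close>, then \<open>p\<close> is a smooth extremal point of the whole of \<open>K\<close>.
  Otherwise \<open>p\<close> would be a corner whose conjugate segment goes up from \<open>q\<close>. As this corner is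
  polyhedral, the face of \<open>K\<close> conjugate to \<open>q\<close> would contain a point \<open>y\<close> below \<open>p\<close>, and \<open>y\<close> and the
  upper end of the segment violate duality.\<close>

lemma smooth_extremal_point_of_one_sided:
  assumes K: "origin_body K" "\<forall>x. corner K x \<longrightarrow> polyhedral_corner K x"
    and pq: "axis_pair p q" "p \<in> K" "q \<in> dual_body K"
    and up: "\<And>v. v \<in> K \<Longrightarrow> v \<bullet> q = - 1 \<Longrightarrow> v $ 2 \<ge> 0 \<Longrightarrow> v = p"
    and down: "\<And>w. w \<in> dual_body K \<Longrightarrow> w \<bullet> p = - 1 \<Longrightarrow> w $ 2 \<le> 0 \<Longrightarrow> w = q"
  shows "smooth_extremal_point K p"
proof -
  have ext: "p extreme_point_of K"
    by (rule extreme_point_of_one_sided[OF pq, of 1]) (rule up, simp_all)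
  have qF: "q \<in> dual_face K p"
    using pq by (simp add: dual_face_def axis_pair_def inner_commute)
  have "w = q" if w: "w \<in> dual_face K p" for w
  proof (rule ccontr)
    assume "w \<noteq> q"
    have wD: "w \<in> dual_body K" "w \<bullet> p = - 1"
      using w by (auto simp: dual_face_def)
    have "w $ 2 > 0"
      using down[OF wD] \<open>w \<noteq> q\<close> by linarith
    have "corner K p"
      using corner_iff[OF K(1)] ext w qF \<open>w \<noteq> q\<close> by blast
    moreover have "p \<in> dual_body (dual_body K)"
      using pq(2) dual_body_dual_body[OF K(1)] by simp
    then have "q extreme_point_of dual_body K"
      by (rule extreme_point_of_one_sided[OF axis_pair_sym[OF pq(1)] pq(3), of "- 1"])
        (rule down, simp_all)
    ultimately obtain y where y: "y \<in> K" "dual_face K y = {q}"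
      using polyhedral_corner_iff[OF K(1)] K(2) qF by blast
    then have yq: "y \<bullet> q = - 1"
      unfolding dual_face_def by (auto simp: inner_commute)
    have "y \<noteq> p"
      using y(2) w \<open>w \<noteq> q\<close> by blast
    then have "y $ 2 < 0"
      using up[OF y(1) yq] by linarith
    have "w $ 1 = q $ 1" "y $ 1 = p $ 1"
      using axis_pair_line[OF axis_pair_sym[OF pq(1)]] axis_pair_line[OF pq(1)] wD(2) yq by auto
    then have "w \<bullet> y = - 1 + w $ 2 * y $ 2"
      using pq(1) by (auto simp: inner_2 axis_pair_def mult.commute)
    moreover have "w $ 2 * y $ 2 < 0"
      using \<open>w $ 2 > 0\<close> \<open>y $ 2 < 0\<close> by (rule mult_pos_neg)
    ultimately show False
      using dual_body_ge(1)[OF wD(1) y(1)] by linarith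
  qed
  then have "dual_face K p = {q}"
    using qF by blast
  then show ?thesis
    using smooth_extremal_point_iff[OF K(1)] ext by blast
qed

text \<open>The only normal direction at such a point is the one conjugate to \<open>q\<close>, so this is the
  direction that exposes the point.\<close>

lemma smooth_extremal_point_axis:
  assumes "origin_body K" "\<nexists>x. nonexposed_point K x" "axis_pair p q" "q \<in> dual_body K"
    and "smooth_extremal_point K p"
  shows "dual_face K p = {q}" "{v \<in> K. v \<bullet> q = - 1} = {p}"
proof -
  obtain r where r: "p extreme_point_of K" "dual_face K p = {r}"
    using assms(5) smooth_extremal_point_iff[OF assms(1)] by blast
  have "q \<in> dual_face K p"
    using assms by (simp add: dual_face_def axis_pair_def inner_commute)
  then show q: "dual_face K p = {q}"
    using r(2) by auto
  obtain w where w: "w \<in> dual_body K" "{v \<in> K. v \<bullet> w = - 1} = {p}"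
    using assms(2) r(1)
    unfolding no_nonexposed_point_iff[OF assms(1)] dual_face_dual_body[OF assms(1)] by blast
  then have "p \<bullet> w = - 1"
    by blast
  then have "w \<in> dual_face K p"
    using w(1) by (simp add: dual_face_def inner_commute)
  then have "w = q"
    using q by simp
  then show "{v \<in> K. v \<bullet> q = - 1} = {p}"
    using w(2) by simp
qed

lemma not_extreme_point_of_two_sided:
  fixes K :: "(real^2) set"
  assumes "u \<in> K" "v \<in> K" "u $ 1 = p $ 1" "v $ 1 = p $ 1" "u $ 2 > 0" "v $ 2 < 0" "p $ 2 = 0"
  shows "\<not> p extreme_point_of K"
proof
  assume "p extreme_point_of K"
  define l where "l = u $ 2 / (u $ 2 - v $ 2)"
  have "0 < l" "l < 1"
    using assms(5,6) by (auto simp: l_def)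
  moreover have "l * (u $ 2 - v $ 2) = u $ 2"
    using assms(5,6) by (simp add: l_def)
  then have "p = (1 - l) *\<^sub>R u + l *\<^sub>R v"
    using assms(3,4,7) by (simp add: vec2_eq_iff algebra_simps)
  moreover have "u \<noteq> v"
    using assms(5,6) by auto
  ultimately have "p \<in> open_segment u v"
    by (auto simp: in_segment)
  then show False
    using \<open>p extreme_point_of K\<close> assms(1,2) by (auto simp: extreme_point_of_def)
qed

text \<open>An extreme point \<open>p\<close> on the axis is exposed vertically if the vertical face at \<open>p\<close> is trivial,
  and is a corner if the vertical face at \<open>q\<close> is not. In the remaining case the face at \<open>p\<close> goes to
  one side only, and the previous lemmas show that exactly one of \<open>p\<close> and \<open>q\<close> is a smooth extremal
  point of \<open>K\<close>: it is \<open>q\<close> if the face goes up, and \<open>p\<close> if it goes down.\<close>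

lemma glue_exposed_on_axis:
  assumes K: "origin_body K" "\<forall>x. corner K x \<longrightarrow> polyhedral_corner K x"
      "\<nexists>x. nonexposed_point K x"
    and L: "dual_body (glue K) = glue K"
    and pq: "axis_pair p q" "p \<in> K" "q \<in> K" "p \<in> dual_body K" "q \<in> dual_body K"
    and smooth: "smooth_extremal_point K p \<longleftrightarrow> smooth_extremal_point K q"
    and p: "p extreme_point_of glue K"
  shows "\<exists>w\<in>glue K. {v \<in> glue K. v \<bullet> w = - 1} = {p}"
proof (rule ccontr)
  assume no: "\<not> (\<exists>w\<in>glue K. {v \<in> glue K. v \<bullet> w = - 1} = {p})"
  have on_axis: "p $ 2 = 0" "q $ 2 = 0" "p \<bullet> q = - 1"
    using pq(1) by (auto simp: axis_pair_def)
  have mem: "p \<in> glue K" "q \<in> glue K"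
    using pq on_axis by (auto simp: mem_glue)
  have ge: "v \<bullet> w \<ge> - 1" if "v \<in> glue K" "w \<in> glue K" for v w
    using dual_body_ge(2)[of w "glue K" v] that L by simp
  note lineq = axis_pair_line[OF pq(1)] and linep = axis_pair_line[OF axis_pair_sym[OF pq(1)]]
  have q_trivial: "w = q" if w: "w \<in> glue K" "w \<bullet> p = - 1" for w
  proof (rule ccontr)
    assume "w \<noteq> q"
    have "w $ 1 = q $ 1"
      using linep w(2) by simp
    then have "w $ 2 \<noteq> 0"
      using \<open>w \<noteq> q\<close> on_axis by (auto simp: vec2_eq_iff)
    \<comment> \<open>a normal strictly between those given by \<open>q\<close> and \<open>w\<close> exposes the corner \<open>p\<close>\<close>
    define m where "m = (1 / 2) *\<^sub>R q + (1 / 2) *\<^sub>R w"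
    have "m \<in> glue K"
      using convexD[OF convex_dual_body[of "glue K"], of q w "1 / 2" "1 / 2"] mem(2) w(1)
      by (simp add: L m_def)
    moreover have "{v \<in> glue K. v \<bullet> m = - 1} = {p}"
    proof -
      have inner_m: "v \<bullet> m = (v \<bullet> q + v \<bullet> w) / 2" for v
        by (simp add: m_def inner_add_right)
      have "v = p" if v: "v \<in> glue K" "v \<bullet> m = - 1" for v
      proof -
        have "v \<bullet> q = - 1" "v \<bullet> w = - 1"
          using v(2) ge[OF v(1) mem(2)] ge[OF v(1) w(1)] unfolding inner_m by simp_all
        then have "v $ 1 = p $ 1" "v $ 2 * w $ 2 = 0"
          using lineq \<open>w $ 1 = q $ 1\<close> on_axis by (auto simp: inner_2)
        then show ?thesis
          using \<open>w $ 2 \<noteq> 0\<close> on_axis by (simp add: vec2_eq_iff)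
      qed
      moreover have "p \<bullet> m = - 1"
        using on_axis(3) w(2) inner_m[of p] by (simp add: inner_commute[of w])
      ultimately show ?thesis
        using mem(1) by blast
    qed
    ultimately show False
      using no by blast
  qed
  obtain v where v: "v \<in> glue K" "v \<bullet> q = - 1" "v \<noteq> p"
    using no mem on_axis(3) by blast
  have v1: "v $ 1 = p $ 1"
    using v(2) lineq by simp
  then have "v $ 2 \<noteq> 0"
    using v(3) on_axis by (auto simp: vec2_eq_iff)
  then consider "v $ 2 > 0" "v \<in> K" | "v $ 2 < 0" "v \<in> dual_body K"
    using v(1) unfolding mem_glue by linarith
  then show False
  proof cases
    case 1
    have "w = p" if w: "w \<in> dual_body K" "w \<bullet> q = - 1" "w $ 2 \<le> 0" for w
    proof (rule ccontr)
      assume "w \<noteq> p"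
      have "w $ 1 = p $ 1"
        using w(2) lineq by simp
      then have "w $ 2 < 0"
        using \<open>w \<noteq> p\<close> w(3) on_axis by (auto simp: vec2_eq_iff)
      moreover have "w \<in> glue K"
        using w by (simp add: mem_glue)
      ultimately show False
        using not_extreme_point_of_two_sided[OF v(1)] v1 \<open>w $ 1 = p $ 1\<close> 1 on_axis p by blast
    qed
    moreover have "u = q" if "u \<in> K" "u \<bullet> p = - 1" "u $ 2 \<ge> 0" for u
      using q_trivial[of u] that by (simp add: mem_glue)
    ultimately have "smooth_extremal_point K q"
      using smooth_extremal_point_of_one_sided[OF K(1,2) axis_pair_sym[OF pq(1)] pq(3,4)] by blast
    then have "{v \<in> K. v \<bullet> q = - 1} = {p}"
      using smooth_extremal_point_axis(2)[OF K(1,3) pq(1,5)] smooth by blast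
    then show False
      using v(2,3) 1(2) by blast
  next
    case 2
    have "u = p" if u: "u \<in> K" "u \<bullet> q = - 1" "u $ 2 \<ge> 0" for u
    proof (rule ccontr)
      assume "u \<noteq> p"
      have "u $ 1 = p $ 1"
        using u(2) lineq by simp
      then have "u $ 2 > 0"
        using \<open>u \<noteq> p\<close> u(3) on_axis by (auto simp: vec2_eq_iff)
      moreover have "u \<in> glue K"
        using u by (simp add: mem_glue)
      ultimately show False
        using not_extreme_point_of_two_sided[of u "glue K" v p] v(1) v1 \<open>u $ 1 = p $ 1\<close> 2 on_axis p
        by blast
    qed
    moreover have "w = q" if "w \<in> dual_body K" "w \<bullet> p = - 1" "w $ 2 \<le> 0" for w
      using q_trivial[of w] that by (simp add: mem_glue)
    ultimately have "smooth_extremal_point K p"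
      using smooth_extremal_point_of_one_sided[OF K(1,2) pq(1,2,5)] by blast
    then have "dual_face K q = {p}"
      using smooth_extremal_point_axis(1)[OF K(1,3) axis_pair_sym[OF pq(1)] pq(4)] smooth by blast
    moreover have "v \<in> dual_face K q"
      using 2 v(2) by (simp add: dual_face_def)
    ultimately show False
      using v(3) by blast
  qed
qed

lemma glue_no_nonexposed_point:
  assumes K: "origin_body K" "\<forall>x. corner K x \<longrightarrow> polyhedral_corner K x"
      "\<nexists>x. nonexposed_point K x"
    and strip: "axis_strip K a c"
    and smooth: "smooth_extremal_point K (- c *\<^sub>R e1) \<longleftrightarrow> smooth_extremal_point K (a *\<^sub>R e1)"
  shows "\<nexists>x. nonexposed_point (glue K) x"
proof -
  note L = dual_body_glue[OF K(1) strip] and oL = origin_body_glue[OF K(1) strip]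
  note D = axis_strip_dual[OF strip] and oD = origin_body_dual[OF K(1)]
  note bidual = dual_body_dual_body[OF K(1)]
  have "\<exists>w\<in>glue K. {v \<in> glue K. v \<bullet> w = - 1} = {x}" if x: "x extreme_point_of glue K" for x
  proof -
    consider "x $ 2 > 0" | "x $ 2 < 0" | "x $ 2 = 0"
      by linarith
    then show ?thesis
    proof cases
      case 1
      have U: "open {v::real^2. v $ 2 > 0}" "x \<in> {v. v $ 2 > 0}"
        "K \<inter> {v. v $ 2 > 0} = glue K \<inter> {v. v $ 2 > 0}"
        using 1 by (auto simp: mem_glue open_halfspace_component_gt_cart)
      have "x extreme_point_of K"
        using extreme_point_of_local[OF x origin_bodyD(3)[OF K(1)] U] .
      then obtain w where "w \<in> dual_body K" "{v \<in> K. v \<bullet> w = - 1} = {x}"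
        using K(3) unfolding no_nonexposed_point_iff[OF K(1)] dual_face_dual_body[OF K(1)] by blast
      from exposed_local[OF this origin_bodyD(3)[OF oL] U] show ?thesis
        unfolding L by blast
    next
      case 2
      have U: "open {v::real^2. v $ 2 < 0}" "x \<in> {v. v $ 2 < 0}"
        "dual_body K \<inter> {v. v $ 2 < 0} = glue K \<inter> {v. v $ 2 < 0}"
        using 2 by (auto simp: mem_glue open_halfspace_component_lt_cart)
      have "x extreme_point_of dual_body K"
        using extreme_point_of_local[OF x origin_bodyD(3)[OF oD] U] .
      then obtain w where "w \<in> dual_body (dual_body K)" "{v \<in> dual_body K. v \<bullet> w = - 1} = {x}"
        using no_nonexposed_point_dual[OF K(1,2)]
        unfolding no_nonexposed_point_iff[OF oD] dual_face_dual_body[OF oD] by blast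
      from exposed_local[OF this origin_bodyD(3)[OF oL] U] show ?thesis
        unfolding L by blast
    next
      case 3
      have ac: "a > 0" "c > 0" "a * c = 1"
        and mem: "a *\<^sub>R e1 \<in> K" "- c *\<^sub>R e1 \<in> K" "a *\<^sub>R e1 \<in> dual_body K" "- c *\<^sub>R e1 \<in> dual_body K"
        using strip D by (auto simp: axis_strip_def)
      have pair: "axis_pair (a *\<^sub>R e1) (- c *\<^sub>R e1)"
        using ac by (simp add: axis_pair_def inner_2)
      have mL: "a *\<^sub>R e1 \<in> glue K" "- c *\<^sub>R e1 \<in> glue K" and x1: "- c \<le> x $ 1" "x $ 1 \<le> a"
        using axis_strip_glue[OF strip] x by (auto simp: axis_strip_def extreme_point_of_def)
      have "x = a *\<^sub>R e1 \<or> x = - c *\<^sub>R e1"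
      proof (rule ccontr)
        assume "\<not> (x = a *\<^sub>R e1 \<or> x = - c *\<^sub>R e1)"
        then have x1': "- c < x $ 1" "x $ 1 < a"
          using x1 3 by (auto simp: vec2_eq_iff order_less_le)
        define l where "l = (x $ 1 + c) / (a + c)"
        have l: "0 < l" "l < 1"
          using x1' ac by (auto simp: l_def)
        have "l * (a + c) = x $ 1 + c"
          using ac by (simp add: l_def)
        then have "x = (1 - l) *\<^sub>R (- c *\<^sub>R e1) + l *\<^sub>R (a *\<^sub>R e1)"
          using 3 by (simp add: vec2_eq_iff algebra_simps)
        moreover have "- c *\<^sub>R e1 \<noteq> a *\<^sub>R e1"
          using ac by (auto simp: vec2_eq_iff)
        ultimately have "x \<in> open_segment (- c *\<^sub>R e1) (a *\<^sub>R e1)"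
          using l unfolding in_segment by blast
        then show False
          using x mL by (auto simp: extreme_point_of_def)
      qed
      then show ?thesis
        using glue_exposed_on_axis[OF K L pair mem(1,2,3,4) smooth[symmetric]]
          glue_exposed_on_axis[OF K L axis_pair_sym[OF pair] mem(2,1,4,3) smooth] x by blast
    qed
  qed
  then show ?thesis
    unfolding no_nonexposed_point_iff[OF oL] dual_face_dual_body[OF oL] unfolding L by blast
qed

section \<open>From radial and support functions to coordinates\<close>

lemma radial_fun_scaled_mem:
  assumes "origin_body K" "u \<noteq> 0"
  shows "radial_fun K u *\<^sub>R u \<in> K"
proof -
  note K = origin_bodyD[OF assms(1)]
  let ?S = "{l. l \<ge> 0 \<and> l *\<^sub>R u \<in> K}"
  obtain B where B: "\<And>v. v \<in> K \<Longrightarrow> norm v \<le> B"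
    using compact_imp_bounded[OF K(1)] unfolding bounded_iff by blast
  have "l \<le> B / norm u" if "l \<in> ?S" for l
    using B[of "l *\<^sub>R u"] that assms(2) by (simp add: field_simps)
  then have "bdd_above ?S"
    by (rule bdd_aboveI)
  moreover have "closed ?S"
  proof -
    have "?S = {0..} \<inter> (\<lambda>l. l *\<^sub>R u) -` K"
      by auto
    moreover have "closed ((\<lambda>l. l *\<^sub>R u) -` K)"
      by (rule closed_vimage[OF K(2)]) (intro continuous_intros)
    ultimately show ?thesis
      by (simp add: closed_Int)
  qed
  moreover have "0 \<in> ?S"
    using K(5) by simp
  then have "?S \<noteq> {}"
    by blast
  ultimately have "Sup ?S \<in> ?S"
    by (intro closed_contains_Sup)
  then show ?thesis
    by (simp add: radial_fun_def)
qed

lemma radial_fun_eqI: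
  assumes "r \<ge> 0" "r *\<^sub>R u \<in> K" "\<And>l. l \<ge> 0 \<Longrightarrow> l *\<^sub>R u \<in> K \<Longrightarrow> l \<le> r"
  shows "radial_fun K u = r"
  unfolding radial_fun_def by (rule cSup_eq_maximum) (use assms in blast)+

lemma inner_e1: "v \<bullet> e1 = v $ 1"
  by (simp add: inner_2)

lemma axis_stripI:
  assumes "origin_body K"
    and "radial_fun K e1 = exp l" "support_fun K e1 = exp l"
    and "radial_fun K (- e1) = exp (- l)" "support_fun K (- e1) = exp (- l)"
  shows "axis_strip K (exp l) (exp (- l))"
proof -
  note K = origin_bodyD[OF assms(1)]
  have ne: "e1 \<noteq> 0"
    by (simp add: vec2_eq_iff)
  have "exp l *\<^sub>R e1 \<in> K"
    using radial_fun_scaled_mem[OF assms(1) ne] assms(2) by simp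
  moreover have "- exp (- l) *\<^sub>R e1 \<in> K"
    using radial_fun_scaled_mem[OF assms(1), of "- e1"] ne assms(4) by simp
  moreover have "- exp (- l) \<le> v $ 1 \<and> v $ 1 \<le> exp l" if "v \<in> K" for v
    using inner_le_support_fun[OF K(1) that, of e1] inner_le_support_fun[OF K(1) that, of "- e1"]
      assms(3,5) by (simp add: inner_e1)
  moreover have "exp l * exp (- l) = 1"
    by (simp add: exp_minus)
  ultimately show ?thesis
    by (simp add: axis_strip_def)
qed

lemma glue_of_gluing_assumptions:
  assumes "gluing_assumptions K"
  shows "origin_body (glue K)" "dual_body (glue K) = glue K" "\<nexists>x. nonexposed_point (glue K) x"
proof -
  have K: "origin_body K" "\<forall>x. corner K x \<longrightarrow> polyhedral_corner K x" "\<nexists>x. nonexposed_point K x"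
    using assms by (auto simp: gluing_assumptions_def origin_body_def)
  obtain l where l: "radial_fun K e1 = exp l" "support_fun K e1 = exp l"
      "radial_fun K (- e1) = exp (- l)" "support_fun K (- e1) = exp (- l)"
    and smooth: "smooth_extremal_point K (- (radial_fun K (- e1) *\<^sub>R e1)) \<longleftrightarrow>
      smooth_extremal_point K (radial_fun K e1 *\<^sub>R e1)"
    using assms unfolding gluing_assumptions_def by blast
  note strip = axis_stripI[OF K(1) l]
  show "origin_body (glue K)"
    by (rule origin_body_glue[OF K(1) strip])
  show "dual_body (glue K) = glue K"
    by (rule dual_body_glue[OF K(1) strip])
  show "\<nexists>x. nonexposed_point (glue K) x"
    using glue_no_nonexposed_point[OF K strip] smooth unfolding l scaleR_minus_left by blast
qed

section \<open>Every self-dual body can be rotated into gluing position\<close>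

text \<open>The end points of a conjugate segment are extreme points of the dual, which is the body itself;
  so they are exposed.\<close>

lemma self_dual_corners_polyhedral:
  assumes "origin_body K" "dual_body K = K" "\<nexists>x. nonexposed_point K x" "corner K x"
  shows "polyhedral_corner K x"
  using polyhedral_corner_iff[OF assms(1,4)] assms(3)
  unfolding no_nonexposed_point_iff[OF assms(1)] assms(2) by blast

text \<open>A self-dual body that touches its circumscribed circle of radius \<open>r\<close> at \<open>p\<close> contains the disc
  of radius \<open>1/r\<close>, by duality, and touches it at the opposite point \<open>q\<close>. The circles bound the
  abscissas, and they force the conjugate face of \<open>q\<close> to be \<open>{p}\<close>; so smoothness of \<open>q\<close> comes for
  free, and \<open>q\<close> is extremal exactly when the conjugate face of \<open>p\<close> is \<open>{q}\<close>.\<close>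

lemma gluing_assumptions_of_circumscribed:
  assumes K: "origin_body K" "dual_body K = K" "\<nexists>x. nonexposed_point K x"
    and r: "r > 0" "r *\<^sub>R e1 \<in> K" "\<And>v. v \<in> K \<Longrightarrow> norm v \<le> r"
  shows "gluing_assumptions K"
proof -
  define p q where "p = r *\<^sub>R e1" and "q = (- 1 / r) *\<^sub>R e1"
  have norm_e1: "norm e1 = 1"
    by (simp add: norm_eq_sqrt_inner inner_2)
  have p: "p \<in> K" "p $ 1 = r" "p $ 2 = 0" "norm p = r"
    using r(1,2) norm_e1 by (simp_all add: p_def)
  have q_comp: "q $ 1 = - 1 / r" "q $ 2 = 0"
    by (simp_all add: q_def)
  have "q \<in> cball 0 (1 / r)"
    using r(1) norm_e1 by (simp add: q_def)
  then have q: "q \<in> K"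
    using cball_subset_dual_body[OF r(3,1)] K(2) by blast
  have pq: "p \<bullet> q = - 1"
    using r(1) p q_comp by (simp add: inner_2)
  have le: "v $ 1 \<le> r" if "v \<in> K" for v
    using r(3)[OF that] component_le_norm_cart[of v 1] by linarith
  have ge: "- 1 / r \<le> v $ 1" if "v \<in> K" for v
  proof -
    have "r * v $ 1 \<ge> - 1"
      using dual_body_ge(1)[of p K v] that p K(2) by (simp add: inner_2)
    then show ?thesis
      using r(1) by (simp add: field_simps)
  qed
  have qe: "q = (1 / r) *\<^sub>R (- e1)"
    by (simp add: q_def)
  have radial: "radial_fun K e1 = r" "radial_fun K (- e1) = 1 / r"
  proof -
    show "radial_fun K e1 = r"
      using r(1,2) le[of "_ *\<^sub>R e1"] by (intro radial_fun_eqI) auto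
    show "radial_fun K (- e1) = 1 / r"
    proof (rule radial_fun_eqI)
      show "1 / r \<ge> 0"
        using r(1) by simp
      show "(1 / r) *\<^sub>R - e1 \<in> K"
        using q unfolding qe .
      fix l :: real assume "l *\<^sub>R - e1 \<in> K"
      from ge[OF this] show "l \<le> 1 / r"
        by simp
    qed
  qed
  have support: "support_fun K e1 = r" "support_fun K (- e1) = 1 / r"
    using support_fun_eqI[OF p(1), of e1] support_fun_eqI[OF q, of "- e1"] le ge
    by (simp_all add: inner_e1 p(2) q_comp minus_le_iff)
  have Fq: "dual_face K q = {p}"
  proof -
    have "w = p" if w: "w \<in> K" "w \<bullet> q = - 1" for w
    proof -
      have "w $ 1 = r"
        using w(2) r(1) q_comp by (simp add: inner_2 field_simps)
      have "w \<bullet> w \<le> r\<^sup>2"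
        using r(3)[OF w(1)] by (simp add: power2_norm_eq_inner[symmetric] power_mono)
      then have "w $ 2 = 0"
        using \<open>w $ 1 = r\<close> by (simp add: inner_2 power2_eq_square[symmetric])
      then show ?thesis
        using \<open>w $ 1 = r\<close> p by (simp add: vec2_eq_iff)
    qed
    then show ?thesis
      using p(1) pq unfolding dual_face_def K(2) by blast
  qed
  have p_ext: "p extreme_point_of K"
  proof -
    have "p \<notin> open_segment a b" if "a \<in> K" "b \<in> K" for a b
      using dist_decreases_open_segment[of p a b 0] r(3) that p(4) by fastforce
    then show ?thesis
      using p(1) by (auto simp: extreme_point_of_def)
  qed
  have Fp: "q \<in> dual_face K p"
    using q pq unfolding dual_face_def K(2) by (simp add: inner_commute)
  have q_ext: "q extreme_point_of K \<longleftrightarrow> dual_face K p = {q}"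
  proof
    assume "q extreme_point_of K"
    then obtain w where w: "w \<in> K" "dual_face K w = {q}"
      using K(3) unfolding no_nonexposed_point_iff[OF K(1)] K(2) by blast
    then have "w \<in> dual_face K q"
      unfolding dual_face_def K(2) by (auto simp: inner_commute)
    then show "dual_face K p = {q}"
      using w(2) Fq by simp
  next
    assume "dual_face K p = {q}"
    then show "q extreme_point_of K"
      using dual_face_face_of[OF K(1) p(1)] K(2) by (simp add: face_of_singleton)
  qed
  have "(\<exists>s. dual_face K p = {s}) \<longleftrightarrow> dual_face K p = {q}"
    using Fp by auto
  then have "smooth_extremal_point K q \<longleftrightarrow> smooth_extremal_point K p"
    unfolding smooth_extremal_point_iff[OF K(1)] using p_ext q_ext Fq by simp
  moreover have "- (radial_fun K (- e1) *\<^sub>R e1) = q" "radial_fun K e1 *\<^sub>R e1 = p"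
    unfolding radial by (simp_all add: p_def q_def)
  moreover have "exp (ln r) = r" "exp (- ln r) = 1 / r"
    using r(1) by (simp_all add: exp_minus field_simps)
  ultimately show ?thesis
    unfolding gluing_assumptions_def radial support
    using K(1,3) self_dual_corners_polyhedral[OF K] unfolding origin_body_def
    by (intro conjI exI[of _ "ln r"]) auto
qed

lemma dual_body_orthogonal_image:
  assumes "orthogonal_transformation f"
  shows "dual_body (f ` K) = f ` dual_body K"
proof -
  have inner: "f u \<bullet> f v = u \<bullet> v" for u v
    using assms by (simp add: orthogonal_transformation_def)
  then have mem: "f u \<in> dual_body (f ` K) \<longleftrightarrow> u \<in> dual_body K" for u
    by (simp add: dual_body_def)
  show ?thesis
  proof (intro equalityI subsetI)
    fix w assume w: "w \<in> dual_body (f ` K)"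
    obtain u where "w = f u"
      using orthogonal_transformation_surj[OF assms] by (rule surjE)
    then show "w \<in> f ` dual_body K"
      using w mem by blast
  qed (use mem in blast)
qed

lemma dual_face_orthogonal_image:
  assumes "orthogonal_transformation f"
  shows "dual_face (f ` K) (f x) = f ` dual_face K x"
  using assms unfolding dual_face_def dual_body_orthogonal_image[OF assms]
  by (auto simp: orthogonal_transformation_def)

lemma origin_body_orthogonal_image:
  assumes "orthogonal_transformation f" "origin_body K"
  shows "origin_body (f ` K)"
proof -
  note K = origin_bodyD[OF assms(2)]
  have f: "linear f" "inj f"
    using assms(1) orthogonal_transformation_linear orthogonal_transformation_inj by blast+
  have "f 0 \<in> interior (f ` K)"
    unfolding interior_injective_linear_image[OF f] using K(4) by blast
  then have "0 \<in> interior (f ` K)"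
    using linear_0[OF f(1)] by simp
  moreover have "compact (f ` K)"
    using compact_continuous_image[OF linear_continuous_on] f(1) K(1)
    by (simp add: linear_conv_bounded_linear)
  moreover have "convex (f ` K)"
    by (rule convex_linear_image[OF f(1) K(3)])
  ultimately show ?thesis
    by (simp add: origin_body_def convex_body_def)
qed

lemma no_nonexposed_point_orthogonal_image:
  assumes f: "orthogonal_transformation f" and K: "origin_body K" "\<nexists>x. nonexposed_point K x"
  shows "\<nexists>x. nonexposed_point (f ` K) x"
  unfolding no_nonexposed_point_iff[OF origin_body_orthogonal_image[OF f K(1)]]
proof (intro allI impI)
  fix x assume x: "x extreme_point_of f ` K"
  then obtain y where y: "x = f y"
    by (auto simp: extreme_point_of_def)
  have "{y} face_of K"
    using x face_of_linear_image[of f "{y}" K] orthogonal_transformation_linear[OF f]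
      orthogonal_transformation_inj[OF f] by (simp add: y face_of_singleton)
  then obtain w where w: "w \<in> dual_body K" "dual_face (dual_body K) w = {y}"
    using K(2) unfolding no_nonexposed_point_iff[OF K(1)] face_of_singleton by blast
  show "\<exists>w\<in>dual_body (f ` K). dual_face (dual_body (f ` K)) w = {x}"
    unfolding dual_body_orthogonal_image[OF f]
    using w dual_face_orthogonal_image[OF f, of "dual_body K" w] by (auto simp: y)
qed

text \<open>The rotation turns a point of maximal norm onto the positive horizontal axis.\<close>

lemma exists_rotation_gluing_assumptions:
  assumes K: "origin_body K" "dual_body K = K" "\<nexists>x. nonexposed_point K x"
  shows "\<exists>R :: real^2^2. rotation_matrix R \<and> gluing_assumptions ((*v) R ` K)"
proof -
  note KD = origin_bodyD[OF K(1)]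
  obtain x where x: "x \<in> K" "\<And>y. y \<in> K \<Longrightarrow> norm y \<le> norm x"
    using continuous_attains_sup[OF KD(1), of norm] KD(5) continuous_on_norm_id by blast
  obtain e where e: "e > 0" "cball 0 e \<subseteq> K"
    using KD(4) mem_interior_cball by blast
  have norm_e1: "norm e1 = 1"
    by (simp add: norm_eq_sqrt_inner inner_2)
  have "e *\<^sub>R e1 \<in> K"
    by (rule subsetD[OF e(2)]) (use e(1) norm_e1 in simp)
  then have "e \<le> norm x"
    using x(2)[of "e *\<^sub>R e1"] e(1) norm_e1 by simp
  then have pos: "norm x > 0"
    using e(1) by linarith
  obtain f :: "real^2 \<Rightarrow> real^2" where f: "orthogonal_transformation f" "det (matrix f) = 1"
      "f x = norm x *\<^sub>R e1"
    using rotation_exists[of x "norm x *\<^sub>R e1"] norm_e1 by auto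
  have lin: "linear f"
    by (rule orthogonal_transformation_linear[OF f(1)])
  have "gluing_assumptions (f ` K)"
  proof (rule gluing_assumptions_of_circumscribed)
    show "origin_body (f ` K)"
      by (rule origin_body_orthogonal_image[OF f(1) K(1)])
    show "dual_body (f ` K) = f ` K"
      using dual_body_orthogonal_image[OF f(1)] K(2) by simp
    show "\<nexists>y. nonexposed_point (f ` K) y"
      by (rule no_nonexposed_point_orthogonal_image[OF f(1) K(1,3)])
    show "norm x *\<^sub>R e1 \<in> f ` K"
      using x(1) f(3) by (metis imageI)
    show "norm v \<le> norm x" if "v \<in> f ` K" for v
      using that x(2) orthogonal_transformation_norm[OF f(1)] by auto
  qed (rule pos)
  moreover have "(*v) (matrix f) = f"
    by (rule matrix_vector_mul(2)[OF lin])
  moreover have "rotation_matrix (matrix f)"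
    using f(1,2) orthogonal_transformation_matrix[of f] by (simp add: rotation_matrix_def)
  ultimately show ?thesis
    by metis
qed

theorem mainTheorem6:
  shows "(\<forall>K :: (real^2) set. gluing_assumptions K \<longrightarrow>
            (let L = (K \<inter> upper_half) \<union> (dual_body K \<inter> lower_half) in
               convex_body L \<and> self_dual L \<and> (\<nexists>x. nonexposed_point L x))) \<and>
         (\<forall>K :: (real^2) set.
            convex_body K \<and> self_dual K \<and> (\<nexists>x. nonexposed_point K x) \<longrightarrow>
            (\<exists>R :: real^2^2. rotation_matrix R \<and> gluing_assumptions ((*v) R ` K)))"
proof (intro conjI allI impI)
  fix K :: "(real^2) set"
  assume "gluing_assumptions K"
  from glue_of_gluing_assumptions[OF this]
  show "let L = (K \<inter> upper_half) \<union> (dual_body K \<inter> lower_half) in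
      convex_body L \<and> self_dual L \<and> (\<nexists>x. nonexposed_point L x)"
    unfolding glue_def[symmetric] Let_def by (simp add: origin_body_def self_dual_def)
next
  fix K :: "(real^2) set"
  assume "convex_body K \<and> self_dual K \<and> (\<nexists>x. nonexposed_point K x)"
  then show "\<exists>R :: real^2^2. rotation_matrix R \<and> gluing_assumptions ((*v) R ` K)"
    by (intro exists_rotation_gluing_assumptions) (simp_all add: origin_body_def self_dual_def)
qed

end
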